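(* Let $|q|<1$ and let $f(-q)=(q;q)_\infty=\prod_{k\ge 1}(1-q^k)$. Set $$P=\frac{f(-q)f(-q^{4})}{q^{5/2}f(-q^{13})f(-q^{52})},\qquad Q=\frac{f(-q^2)^2}{q^{2}f(-q^{26})^2},$$ and write $u=\frac{P}{Q}+\frac{Q}{P}$ and $B=PQ+\frac{169}{PQ}$. Then $$B^2=B\left(u^9-u^7-21u^5+35u^3+30u\right)-u^{12}-4u^{10}+26u^8-89u^6+829u^4-1821u^2+576.$$
   Context: $(a;q)_\infty=\prod_{n\ge0}(1-aq^n)$. Fractional powers of $q$ are taken consistently, e.g. writing $q=e^{2\pi i\tau}$ with $\operatorname{Im}\tau>0$ and $q^r=e^{2\pi i r\tau}$. *)

theory Defs
  imports "HOL-Analysis.Analysis"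
begin

definition qpochhammer_inf :: "complex \<Rightarrow> complex \<Rightarrow> complex" where
  "qpochhammer_inf a q = (\<Prod>n. 1 - a * q ^ n)"

(* f(-q) = (q; q)_infinity, i.e. f(x) = (-x; -x)_infinity. *)
definition ramanujan_f :: "complex \<Rightarrow> complex" where
  "ramanujan_f x = qpochhammer_inf (- x) (- x)"

(* q^r for q = exp (2 pi i \<tau>): the branch of a fractional power of q is fixed by \<tau>, and in
   general differs from the principal branch that q powr r would give. *)
definition qpow :: "complex \<Rightarrow> real \<Rightarrow> complex" where
  "qpow \<tau> r = exp (2 * of_real pi * \<i> * of_real r * \<tau>)"

end

theory Submission
  imports Defs "HOL-Complex_Analysis.Complex_Analysis"
begin

text \<open>
  Since \<open>f(-q) f(q) f(-q\<^sup>4) = f(-q\<^sup>2)\<^sup>3\<close>, replacing \<open>\<tau>\<close> by \<open>\<tau> + 1/2\<close> turns \<open>- P\<^sup>2\<close> and \<open>Q\<close> into eta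
  quotients \<open>A\<close> and \<open>C\<close> of level 26. The claim is a rational relation between \<open>P\<^sup>2\<close> and \<open>Q\<close>, because
  \<open>u\<^sup>2\<close>, \<open>B u\<close> and \<open>B\<^sup>2\<close> are rational in them. Only squares of the eta function occur, so the
  multiplier system is a character of \<open>SL\<^sub>2(\<int>)\<close> of order 12, and \<open>A\<close>, \<open>C\<close> are seen to be invariant
  under \<open>\<Gamma>\<^sub>0(26)\<close>, while an Atkin-Lehner involution maps them to \<open>169 / A\<close> and \<open>13 / C\<close>. The
  difference of the two sides is therefore a holomorphic function on the upper half plane with
  finitely many \<open>SL\<^sub>2(\<int>)\<close>-translates. By its expansions at the two inequivalent cusps it is bounded
  at all cusps and vanishes at infinity; the product of its translates is then invariant under
  \<open>SL\<^sub>2(\<int>)\<close> and vanishes at infinity, and hence is zero by the maximum modulus principle.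

  The inversion formula of the eta function comes from the Jacobi theta product: by Liouville's
  theorem \<open>exp (- \<pi> \<i> z\<^sup>2 / \<tau>) \<theta>(z / \<tau>, - 1 / \<tau>)\<close> is a constant multiple of \<open>\<theta>(z, \<tau>)\<close>, and
  comparing the derivatives at 0 with the values at the three half periods determines the constant.
\<close>

section \<open>Infinite products\<close>

abbreviation "qp \<equiv> qpochhammer_inf"

lemma qp_abs_convergent:
  fixes a q :: complex
  assumes "norm q < 1"
  shows "abs_convergent_prod (\<lambda>n. 1 - a * q ^ n)"
proof -
  have "summable (\<lambda>n. norm a * norm q ^ n)"
    using assms by (intro summable_mult summable_geometric) simp
  thus ?thesis
    by (simp add: abs_convergent_prod_conv_summable norm_mult norm_power del: summable_cmult_iff)
qed

lemma qp_has_prod: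
  assumes "norm q < 1"
  shows "(\<lambda>n. 1 - a * q ^ n) has_prod qp a q"
  unfolding qpochhammer_inf_def
  using abs_convergent_prod_imp_convergent_prod[OF qp_abs_convergent[OF assms]]
  by (simp add: convergent_prod_has_prod_iff)

lemma qp_tendsto:
  assumes "norm q < 1"
  shows "(\<lambda>n. \<Prod>k<n. 1 - a * q ^ k) \<longlonglongrightarrow> qp a q"
  using has_prod_imp_tendsto'[OF qp_has_prod[OF assms]] .

lemma qp_eq_0_iff:
  assumes "norm q < 1"
  shows "qp a q = 0 \<longleftrightarrow> (\<exists>n. a * q ^ n = 1)"
  using has_prod_eq_0_iff[OF qp_has_prod[OF assms, of a]] by auto

lemma qp_0 [simp]: "qp 0 q = 1"
  by (simp add: qpochhammer_inf_def)

lemma qp_split_initial: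
  assumes "norm q < 1"
  shows "qp a q = (\<Prod>k<n. 1 - a * q ^ k) * qp (a * q ^ n) q"
proof -
  have "(\<lambda>m. \<Prod>k<m+n. 1 - a * q ^ k) \<longlonglongrightarrow> qp a q"
    using qp_tendsto[OF assms] by (rule LIMSEQ_ignore_initial_segment)
  moreover have "(\<Prod>k<m+n. 1 - a * q ^ k) =
      (\<Prod>k<n. 1 - a * q ^ k) * (\<Prod>k<m. 1 - (a * q ^ n) * q ^ k)" for m
    by (induction m) (simp_all add: power_add mult_ac)
  ultimately have "(\<lambda>m. (\<Prod>k<n. 1 - a * q ^ k) * (\<Prod>k<m. 1 - (a * q ^ n) * q ^ k)) \<longlonglongrightarrow> qp a q"
    by simp
  moreover have "(\<lambda>m. (\<Prod>k<n. 1 - a * q ^ k) * (\<Prod>k<m. 1 - (a * q ^ n) * q ^ k))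
      \<longlonglongrightarrow> (\<Prod>k<n. 1 - a * q ^ k) * qp (a * q ^ n) q"
    by (intro tendsto_intros qp_tendsto assms)
  ultimately show ?thesis
    using LIMSEQ_unique by blast
qed

lemma qp_shift:
  assumes "norm q < 1"
  shows "qp a q = (1 - a) * qp (a * q) q"
  using qp_split_initial[OF assms, of a 1] by simp

lemma qp_mult_minus:
  assumes "norm q < 1"
  shows "qp a q * qp (-a) q = qp (a\<^sup>2) (q\<^sup>2)"
proof -
  have q2: "norm (q\<^sup>2) < 1"
    using assms by (simp add: norm_power power_less_one_iff)
  have "(\<lambda>n. (1 - a * q ^ n) * (1 - (-a) * q ^ n)) has_prod (qp a q * qp (-a) q)"
    by (intro has_prod_mult qp_has_prod assms)
  also have "(\<lambda>n. (1 - a * q ^ n) * (1 - (-a) * q ^ n)) = (\<lambda>n. 1 - a\<^sup>2 * (q\<^sup>2) ^ n)"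
    by (rule ext) (simp add: algebra_simps power2_eq_square power_mult_distrib)
  finally show ?thesis
    using qp_has_prod[OF q2, of "a\<^sup>2"] has_prod_unique by metis
qed

lemma qp_even_odd:
  assumes "norm q < 1"
  shows "qp a (q\<^sup>2) * qp (a * q) (q\<^sup>2) = qp a q"
proof -
  have q2: "norm (q\<^sup>2) < 1"
    using assms by (simp add: norm_power power_less_one_iff)
  have "(\<lambda>n. (\<Prod>k<n. 1 - a * (q\<^sup>2) ^ k) * (\<Prod>k<n. 1 - (a * q) * (q\<^sup>2) ^ k))
      \<longlonglongrightarrow> qp a (q\<^sup>2) * qp (a * q) (q\<^sup>2)"
    by (intro tendsto_intros qp_tendsto q2)
  moreover have "(\<Prod>k<n. 1 - a * (q\<^sup>2) ^ k) * (\<Prod>k<n. 1 - (a * q) * (q\<^sup>2) ^ k) =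
      (\<Prod>k<2*n. 1 - a * q ^ k)" for n
    by (induction n) (simp_all add: power_mult [symmetric] power_add mult_ac)
  moreover have "(\<lambda>n. \<Prod>k<2*n. 1 - a * q ^ k) \<longlonglongrightarrow> qp a q"
    using LIMSEQ_subseq_LIMSEQ[OF qp_tendsto[OF assms, of a], of "\<lambda>n. 2 * n"]
    by (simp add: strict_mono_def comp_def)
  ultimately show ?thesis
    using LIMSEQ_unique by (metis (no_types, lifting) ext)
qed

text \<open>On a closed disc \<open>norm (g w)\<close> attains a maximum below 1 and
  \<open>f\<close> is bounded, so a geometric series majorises the deviations of the factors from 1.
  The partial products therefore converge locally uniformly.\<close>

lemma qp_holomorphic [holomorphic_intros]:
  assumes f: "f holomorphic_on A" and g: "g holomorphic_on A" and A: "open A"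
    and lt: "\<And>z. z \<in> A \<Longrightarrow> norm (g z) < 1"
  shows "(\<lambda>z. qp (f z) (g z)) holomorphic_on A"
proof (rule holomorphic_uniform_sequence[OF A])
  show "(\<lambda>z. \<Prod>k<n. 1 - f z * g z ^ k) holomorphic_on A" for n
    by (intro holomorphic_intros f g)
next
  fix z assume "z \<in> A"
  then obtain d where d: "d > 0" "cball z d \<subseteq> A"
    using A open_contains_cball by blast
  have contf: "continuous_on (cball z d) f" and contg: "continuous_on (cball z d) g"
    using holomorphic_on_imp_continuous_on holomorphic_on_subset f g d(2) by blast+
  have "compact (f ` cball z d)"
    using contf by (intro compact_continuous_image) auto
  then obtain Mf where Mf: "\<And>w. w \<in> cball z d \<Longrightarrow> norm (f w) \<le> Mf"
    using compact_imp_bounded bounded_iff by (metis imageI)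
  have "\<exists>x\<in>cball z d. \<forall>w\<in>cball z d. norm (g w) \<le> norm (g x)"
    using d(1) contg by (intro continuous_attains_sup continuous_intros) auto
  then obtain x where x: "x \<in> cball z d" "\<And>w. w \<in> cball z d \<Longrightarrow> norm (g w) \<le> norm (g x)"
    by blast
  have unif: "uniformly_convergent_on (cball z d) (\<lambda>n w. \<Prod>k<n. 1 - f w * g w ^ k)"
  proof (rule uniformly_convergent_on_prod')
    show "uniformly_convergent_on (cball z d) (\<lambda>n w. \<Sum>k<n. norm (1 - f w * g w ^ k - 1))"
    proof (rule Weierstrass_m_test'_ev, rule always_eventually, safe)
      fix n w assume w: "w \<in> cball z d"
      show "norm (norm (1 - f w * g w ^ n - 1)) \<le> Mf * norm (g x) ^ n"
        using Mf[OF w] x(2)[OF w] order_trans[OF norm_ge_zero Mf[OF w]]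
        by (auto simp: norm_mult norm_power intro!: mult_mono power_mono)
    next
      show "summable (\<lambda>n. Mf * norm (g x) ^ n)"
        using lt[of x] x(1) d(2) by (intro summable_mult summable_geometric) auto
    qed
  qed (auto intro!: continuous_intros contf contg)
  have "uniform_limit (cball z d) (\<lambda>n w. \<Prod>k<n. 1 - f w * g w ^ k) (\<lambda>w. qp (f w) (g w)) sequentially"
  proof -
    obtain h where h: "uniform_limit (cball z d) (\<lambda>n w. \<Prod>k<n. 1 - f w * g w ^ k) h sequentially"
      using unif by (auto simp: uniformly_convergent_on_def)
    moreover have "h w = qp (f w) (g w)" if "w \<in> cball z d" for w
      using tendsto_uniform_limitI[OF h that] qp_tendsto[of "g w" "f w"] lt[of w] that d(2) LIMSEQ_unique
      by blast
    ultimately show ?thesis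
      by (metis (no_types, lifting) uniform_limit_cong')
  qed
  with d show "\<exists>d>0. cball z d \<subseteq> A \<and>
      uniform_limit (cball z d) (\<lambda>n w. \<Prod>k<n. 1 - f w * g w ^ k) (\<lambda>w. qp (f w) (g w)) sequentially"
    by blast
qed

text \<open>Euler's identity of distinct and odd parts. Multiplication by the nonzero
  \<open>qp q q\<close> lets \<open>qp_mult_minus\<close> and \<open>qp_even_odd\<close> absorb the
  two products one after the other.\<close>

lemma qp_euler:
  assumes "norm q < 1"
  shows "qp (-q) q * qp q (q\<^sup>2) = 1"
proof -
  have q2: "norm (q\<^sup>2) < 1"
    using assms by (simp add: norm_power power_less_one_iff)
  have "qp q q * (qp (-q) q * qp q (q\<^sup>2)) = qp (q\<^sup>2) (q\<^sup>2) * qp q (q\<^sup>2)"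
    using qp_mult_minus[OF assms, of q] by (simp add: mult_ac)
  also have "\<dots> = qp q q"
    using qp_even_odd[OF assms, of q] by (simp add: power2_eq_square mult_ac)
  finally have "qp q q * (qp (-q) q * qp q (q\<^sup>2)) = qp q q * 1"
    by simp
  moreover have "qp q q \<noteq> 0"
    using assms norm_power[of q "Suc _"] power_Suc_less_one[of "norm q"]
    unfolding qp_eq_0_iff[OF assms]
    by (metis less_irrefl norm_ge_zero norm_one power_0 power_Suc power_less_one_iff norm_power nat.distinct(1) zero_less_Suc)
  ultimately show ?thesis
    by (metis mult_left_cancel)
qed

section \<open>The Jacobi theta product and the inversion formula for the eta function\<close>

lemma qpow_nonzero [simp]: "qpow \<tau> r \<noteq> 0"
  by (simp add: qpow_def)

lemma qpow_power: "qpow \<tau> r ^ n = qpow \<tau> (real n * r)"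
  by (simp add: qpow_def exp_of_nat_mult [symmetric] algebra_simps)

lemma norm_qpow: "norm (qpow \<tau> r) = exp (- 2 * pi * r * Im \<tau>)"
  by (simp add: qpow_def)

lemma norm_qpow_less_1:
  assumes "Im \<tau> > 0" and "r > 0"
  shows "norm (qpow \<tau> r) < 1"
  using assms by (simp add: norm_qpow mult_pos_pos)

lemma qpow_scale: "qpow (of_real c * \<tau>) r = qpow \<tau> (c * r)"
  by (simp add: qpow_def algebra_simps)

lemma qpow_holomorphic [holomorphic_intros]:
  assumes "f holomorphic_on A"
  shows "(\<lambda>z. qpow (f z) r) holomorphic_on A"
  unfolding qpow_def using assms by (intro holomorphic_intros)

lemma qp_same_nonzero:
  fixes q :: complex
  assumes "norm q < 1"
  shows "qp q q \<noteq> 0"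
proof
  assume "qp q q = 0"
  then obtain n where "q ^ Suc n = 1"
    by (auto simp: qp_eq_0_iff[OF assms])
  hence "norm q ^ Suc n = 1"
    by (metis norm_power norm_one)
  moreover have "norm q ^ Suc n < 1"
    using assms by (subst power_less_one_iff) auto
  ultimately show False by simp
qed

text \<open>The codomain is arbitrary because the lemma serves for complex functions as well as for
  the predicate "is a zero of \<open>h\<close>", which is periodic even where \<open>h\<close> is
  only quasi-periodic.\<close>

lemma periodic_of_int_mult:
  fixes f :: "complex \<Rightarrow> 'a"
  assumes "\<And>z. f (z + w) = f z"
  shows "f (z + of_int m * w) = f z"
proof (induction m arbitrary: z rule: int_induct[of _ 0])
  case (step1 i)
  thus ?case using assms[of "z + of_int i * w"] by (simp add: algebra_simps)
next
  case (step2 i)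
  thus ?case using assms[of "z + of_int (i - 1) * w"] by (simp add: algebra_simps)
qed simp

lemma Im_minus_inverse_pos:
  assumes "Im \<tau> > 0"
  shows "Im (-1 / \<tau>) > 0"
proof -
  have "(Re \<tau>)\<^sup>2 + (Im \<tau>)\<^sup>2 > 0"
    using assms by (intro add_nonneg_pos) auto
  thus ?thesis
    using assms by (simp add: Im_divide)
qed

text \<open>All values are already taken on the compact period parallelogram \<open>S\<close>, so
  the function is bounded and Liouville's theorem applies.\<close>

lemma doubly_periodic_entire_const:
  assumes hol: "f holomorphic_on UNIV" and tau: "Im \<tau> > 0"
    and per1: "\<And>z. f (z + 1) = f z" and per2: "\<And>z. f (z + \<tau>) = f z"
  shows "f z = f 0"
proof -
  have int1: "f (z + of_int m) = f z" and int2: "f (z + of_int m * \<tau>) = f z" for z and m :: int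
    using periodic_of_int_mult[of f 1 z m] periodic_of_int_mult[of f \<tau> z m] per1 per2 by simp_all
  define S where "S = (\<lambda>(s, t). of_real s + of_real t * \<tau>) ` ({0..1} \<times> {0..1::real})"
  have "compact S"
    unfolding S_def case_prod_unfold
    by (intro compact_continuous_image continuous_intros compact_Times) auto
  have "continuous_on S f"
    using hol holomorphic_on_imp_continuous_on continuous_on_subset by blast
  hence "bounded (f ` S)"
    using \<open>compact S\<close> compact_continuous_image compact_imp_bounded by blast
  moreover have "range f \<subseteq> f ` S"
  proof
    fix w assume "w \<in> range f"
    then obtain z where w: "w = f z" by blast
    define t where "t = Im z / Im \<tau>"
    define s where "s = Re z - t * Re \<tau>"
    have z: "z = of_real s + of_real t * \<tau>"
      using tau by (simp add: complex_eq_iff s_def t_def)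
    have "z = (of_real (frac s) + of_real (frac t) * \<tau>) + of_int \<lfloor>s\<rfloor> + of_int \<lfloor>t\<rfloor> * \<tau>"
      by (simp add: z frac_def algebra_simps)
    hence "f z = f (of_real (frac s) + of_real (frac t) * \<tau>)"
      using int1 int2 by metis
    moreover have "of_real (frac s) + of_real (frac t) * \<tau> \<in> S"
      unfolding S_def by (rule image_eqI[of _ _ "(frac s, frac t)"]) (auto simp: frac_lt_1 less_imp_le)
    ultimately show "w \<in> f ` S" by (simp add: w)
  qed
  ultimately have "bounded (range f)"
    using bounded_subset by blast
  hence "f constant_on UNIV"
    by (rule Liouville_theorem[OF hol])
  thus ?thesis
    unfolding constant_on_def by (metis UNIV_I)
qed

text \<open>Up to a factor independent of \<open>z\<close> this is Jacobi's theta function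
  \<open>theta_1\<close>, in product form. The exponential in front makes it odd in
  \<open>z\<close>.\<close>

definition jtheta :: "complex \<Rightarrow> complex \<Rightarrow> complex" where
  "jtheta \<tau> z = exp (- (of_real pi * \<i> * z)) * qp (exp (2 * of_real pi * \<i> * z)) (qpow \<tau> 1) *
     qp (qpow \<tau> 1 * exp (- (2 * of_real pi * \<i> * z))) (qpow \<tau> 1)"

lemma jtheta_holomorphic [holomorphic_intros]:
  assumes "Im \<tau> > 0" and "f holomorphic_on A" and "open A"
  shows "(\<lambda>z. jtheta \<tau> (f z)) holomorphic_on A"
  unfolding jtheta_def
  by (intro holomorphic_intros assms norm_qpow_less_1) auto

lemma jtheta_add_1: "jtheta \<tau> (z + 1) = - jtheta \<tau> z"
proof -
  have *: "exp (2 * of_real pi * \<i> * (z + 1)) = exp (2 * of_real pi * \<i> * z)"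
    by (simp add: algebra_simps exp_add)
  moreover from * have "exp (- (2 * of_real pi * \<i> * (z + 1))) = exp (- (2 * of_real pi * \<i> * z))"
    by (simp only: exp_minus)
  moreover have "exp (of_real pi * \<i> * (z + 1)) = - exp (of_real pi * \<i> * z)"
    by (simp add: algebra_simps exp_add)
  hence "exp (- (of_real pi * \<i> * (z + 1))) = - exp (- (of_real pi * \<i> * z))"
    by (simp add: exp_minus)
  ultimately show ?thesis
    by (simp add: jtheta_def)
qed

text \<open>The shift multiplies \<open>w = exp (2 pi i z)\<close> by \<open>q\<close>: the first
  product loses the factor \<open>1 - w\<close> and the second gains \<open>1 - 1 / w\<close>, and
  the quotient of these is a monomial in \<open>w\<close>.\<close>

lemma jtheta_add_tau:
  assumes "Im \<tau> > 0"
  shows "jtheta \<tau> (z + \<tau>) = - exp (- (of_real pi * \<i> * (\<tau> + 2 * z))) * jtheta \<tau> z"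
proof -
  define q where "q = qpow \<tau> 1"
  define w where "w = exp (2 * of_real pi * \<i> * z)"
  have q: "norm q < 1" and q0: "q \<noteq> 0"
    using norm_qpow_less_1[OF assms, of 1] by (simp_all add: q_def)
  have w0: "w \<noteq> 0" by (simp add: w_def)
  have 1: "exp (2 * of_real pi * \<i> * (z + \<tau>)) = w * q"
    by (simp add: w_def q_def qpow_def exp_add [symmetric] algebra_simps)
  have 2: "exp (- (2 * of_real pi * \<i> * (z + \<tau>))) = inverse (w * q)"
    using 1 by (simp add: exp_minus)
  have 3: "exp (- (of_real pi * \<i> * (z + \<tau>))) =
      exp (- (of_real pi * \<i> * (\<tau> + 2 * z))) * exp (- (of_real pi * \<i> * z)) * w"
    by (simp add: w_def exp_add [symmetric] algebra_simps)
  have 4: "qp (inverse w) q = (1 - inverse w) * qp (q * inverse w) q"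
    using qp_shift[OF q, of "inverse w"] by (simp only: mult_ac)
  have 5: "qp w q = (1 - w) * qp (w * q) q"
    by (rule qp_shift[OF q])
  have 6: "exp (- (2 * of_real pi * \<i> * z)) = inverse w"
    by (simp add: w_def exp_minus)
  have "jtheta \<tau> (z + \<tau>) = exp (- (of_real pi * \<i> * (\<tau> + 2 * z))) * exp (- (of_real pi * \<i> * z)) * w *
          qp (w * q) q * qp (q * inverse (w * q)) q"
    by (simp only: jtheta_def 1 2 3 q_def [symmetric])
  also have "q * inverse (w * q) = inverse w"
    using q0 by (simp add: field_simps)
  also have "exp (- (of_real pi * \<i> * (\<tau> + 2 * z))) * exp (- (of_real pi * \<i> * z)) * w * qp (w * q) q * qp (inverse w) q =
      - exp (- (of_real pi * \<i> * (\<tau> + 2 * z))) * (exp (- (of_real pi * \<i> * z)) * qp w q * qp (q * inverse w) q)"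
    unfolding 4 5 using w0 by (simp add: field_simps)
  also have "exp (- (of_real pi * \<i> * z)) * qp w q * qp (q * inverse w) q = jtheta \<tau> z"
    by (simp only: jtheta_def 6 q_def [symmetric] w_def [symmetric])
  finally show ?thesis .
qed

lemma jtheta_eq_0D:
  assumes "Im \<tau> > 0" and "jtheta \<tau> z = 0"
  obtains m n :: int where "z = of_int m + of_int n * \<tau>"
proof -
  define q where "q = qpow \<tau> 1"
  have q: "norm q < 1"
    using norm_qpow_less_1[OF assms(1), of 1] by (auto simp: q_def)
  have qn: "q ^ n = exp (2 * of_real pi * \<i> * (of_nat n * \<tau>))" for n
    by (simp add: q_def qpow_def exp_of_nat_mult [symmetric] algebra_simps)
  have "(\<exists>n. exp (2 * of_real pi * \<i> * z) * q ^ n = 1) \<or>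
        (\<exists>n. exp (- (2 * of_real pi * \<i> * z)) * q ^ Suc n = 1)"
    using assms(2) qp_eq_0_iff[OF q] by (auto simp: jtheta_def q_def mult_ac)
  \<comment> \<open>The sign \<open>s\<close> records which of the two products vanishes, so that
    both are handled by one computation. In the second product the exponent is shifted by
    one.\<close>
  then obtain n :: nat and s :: complex where s: "s = 1 \<or> s = -1"
    "exp (s * (2 * of_real pi * \<i> * z)) * q ^ n = 1"
    by (metis mult_1 mult_minus1)
  have "exp (2 * of_real pi * \<i> * (s * z + of_nat n * \<tau>)) = 1"
    using s(2) unfolding qn by (simp add: exp_add [symmetric] algebra_simps)
  then obtain k :: int where "2 * of_real pi * \<i> * (s * z + of_nat n * \<tau>) = of_real (of_int (2 * k) * pi) * \<i>"
    unfolding exp_eq_1 by (auto simp: complex_eq_iff)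
  hence "(2 * of_real pi * \<i>) * (s * z + of_nat n * \<tau>) = (2 * of_real pi * \<i>) * of_int k"
    by (simp add: mult_ac)
  hence k: "s * z + of_nat n * \<tau> = of_int k"
    by (subst (asm) mult_cancel_left) simp
  from s(1) show ?thesis
  proof
    assume "s = 1"
    with k have "z = of_int k + of_int (- int n) * \<tau>" by (simp add: algebra_simps)
    thus ?thesis by (rule that)
  next
    assume "s = -1"
    with k have "z = of_int (- k) + of_int (int n) * \<tau>" by (simp add: algebra_simps)
    thus ?thesis by (rule that)
  qed
qed

lemma jtheta_0 [simp]: "jtheta \<tau> 0 = 0" if "Im \<tau> > 0"
  using qp_eq_0_iff[OF norm_qpow_less_1[OF that, of 1], of 1] 
  by (auto simp: jtheta_def intro: exI[of _ 0])

text \<open>The factor \<open>1 - exp (2 pi i z)\<close> of the first product carries the zero and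
  contributes its derivative; the remaining factor \<open>g\<close> is continuous at 0.\<close>

lemma jtheta_limit_0:
  assumes "Im \<tau> > 0"
  shows "((\<lambda>z. jtheta \<tau> z / z) \<longlongrightarrow> - 2 * of_real pi * \<i> * qp (qpow \<tau> 1) (qpow \<tau> 1) ^ 2) (at 0)"
proof -
  define q where "q = qpow \<tau> 1"
  have q: "norm q < 1"
    using norm_qpow_less_1[OF assms, of 1] by (auto simp: q_def)
  define g where "g = (\<lambda>z. exp (- (of_real pi * \<i> * z)) * qp (exp (2 * of_real pi * \<i> * z) * q) q *
     qp (q * exp (- (2 * of_real pi * \<i> * z))) q)"
  have "g holomorphic_on UNIV"
    unfolding g_def by (intro holomorphic_intros q) auto
  hence "isCont g 0"
    using holomorphic_on_imp_continuous_on continuous_on_eq_continuous_at open_UNIV by blast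
  hence g: "(g \<longlongrightarrow> qp q q ^ 2) (at 0)"
    by (simp add: isCont_def g_def power2_eq_square)
  have "((\<lambda>z. 1 - exp (2 * of_real pi * \<i> * z)) has_field_derivative - (2 * of_real pi * \<i>)) (at 0)"
    by (auto intro!: derivative_eq_intros)
  hence "((\<lambda>z. (1 - exp (2 * of_real pi * \<i> * z)) / z) \<longlongrightarrow> - (2 * of_real pi * \<i>)) (at 0)"
    by (simp add: has_field_derivative_iff)
  from tendsto_mult[OF this g]
  have "((\<lambda>z. (1 - exp (2 * of_real pi * \<i> * z)) / z * g z) \<longlongrightarrow> - (2 * of_real pi * \<i>) * qp q q ^ 2) (at 0)" .
  moreover have "(\<lambda>z. (1 - exp (2 * of_real pi * \<i> * z)) / z * g z) = (\<lambda>z. jtheta \<tau> z / z)"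
    using qp_shift[OF q, of "exp (2 * of_real pi * \<i> * _)"]
    by (simp add: fun_eq_iff jtheta_def g_def q_def)
  ultimately show ?thesis unfolding q_def by simp
qed

text \<open>The left side \<open>h\<close> obeys the same two quasi-periodicity rules as
  \<open>jtheta \<tau>\<close>, whose zeros all lie in the lattice, so their quotient extends to an
  elliptic function without poles. The constant \<open>K\<close> is the ratio of the derivatives at
  0.\<close>

lemma jtheta_S_transform:
  assumes tau: "Im \<tau> > 0"
  defines "K \<equiv> qp (qpow (-1/\<tau>) 1) (qpow (-1/\<tau>) 1) ^ 2 / (\<tau> * qp (qpow \<tau> 1) (qpow \<tau> 1) ^ 2)"
  shows "exp (- (of_real pi * \<i> * z\<^sup>2 / \<tau>)) * jtheta (-1/\<tau>) (z / \<tau>) = K * jtheta \<tau> z"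
proof -
  have tau0: "\<tau> \<noteq> 0" using tau by auto
  define \<sigma> where "\<sigma> = -1 / \<tau>"
  have sigma: "Im \<sigma> > 0"
    using Im_minus_inverse_pos[OF tau] by (simp add: \<sigma>_def)
  have nz: "qp (qpow \<tau> 1) (qpow \<tau> 1) \<noteq> 0"
    by (intro qp_same_nonzero norm_qpow_less_1 tau) auto
  define h where "h = (\<lambda>z. exp (- (of_real pi * \<i> * z\<^sup>2 / \<tau>)) * jtheta \<sigma> (z / \<tau>))"
  have h1: "h (z + 1) = - h z" for z
  proof -
    have 1: "jtheta \<sigma> (z / \<tau>) = - exp (- (of_real pi * \<i> * (\<sigma> + 2 * ((z + 1) / \<tau>)))) * jtheta \<sigma> ((z + 1) / \<tau>)"
      using jtheta_add_tau[OF sigma, of "(z + 1) / \<tau>"] by (simp add: \<sigma>_def diff_divide_distrib add_divide_distrib)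
    have 2: "exp (- (of_real pi * \<i> * z\<^sup>2 / \<tau>)) * exp (- (of_real pi * \<i> * (\<sigma> + 2 * ((z + 1) / \<tau>)))) =
          exp (- (of_real pi * \<i> * (z + 1)\<^sup>2 / \<tau>))"
    proof -
      have "- (of_real pi * \<i> * z\<^sup>2 / \<tau>) - of_real pi * \<i> * (\<sigma> + 2 * ((z + 1) / \<tau>)) =
          - (of_real pi * \<i> * (z + 1)\<^sup>2 / \<tau>)"
        using tau0 by (simp add: \<sigma>_def field_simps power2_eq_square)
      thus ?thesis by (simp add: exp_add [symmetric])
    qed
    show ?thesis
      unfolding h_def 1 2 [symmetric] by simp
  qed
  have h2: "h (z + \<tau>) = - exp (- (of_real pi * \<i> * (\<tau> + 2 * z))) * h z" for z
  proof -
    have 1: "jtheta \<sigma> ((z + \<tau>) / \<tau>) = - jtheta \<sigma> (z / \<tau>)"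
      using jtheta_add_1[of \<sigma> "z / \<tau>"] tau0 by (simp add: add_divide_distrib)
    have 2: "exp (- (of_real pi * \<i> * (z + \<tau>)\<^sup>2 / \<tau>)) =
          exp (- (of_real pi * \<i> * (\<tau> + 2 * z))) * exp (- (of_real pi * \<i> * z\<^sup>2 / \<tau>))"
    proof -
      have "- (of_real pi * \<i> * (z + \<tau>)\<^sup>2 / \<tau>) =
          - (of_real pi * \<i> * (\<tau> + 2 * z)) + - (of_real pi * \<i> * z\<^sup>2 / \<tau>)"
        using tau0 by (simp add: field_simps power2_eq_square)
      thus ?thesis by (simp only: exp_add [symmetric])
    qed
    show ?thesis
      unfolding h_def 1 2 by simp
  qed
  have hol_h: "h holomorphic_on A" if "open A" for A
    unfolding h_def using tau0 that by (intro holomorphic_intros sigma) auto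
  have hol_th: "jtheta \<tau> holomorphic_on A" if "open A" for A
    using jtheta_holomorphic[OF tau holomorphic_on_ident that] by simp
  have lim_h: "((\<lambda>z. h z / z) \<longlongrightarrow> - 2 * of_real pi * \<i> * qp (qpow \<sigma> 1) (qpow \<sigma> 1) ^ 2 / \<tau>) (at 0)"
  proof -
    have "filterlim (\<lambda>z. z / \<tau>) (at 0) (at 0)"
      using tau0 by (auto simp: filterlim_at eventually_at_filter intro!: tendsto_eq_intros)
    from filterlim_compose[OF jtheta_limit_0[OF sigma] this]
    have "((\<lambda>z. exp (- (of_real pi * \<i> * z\<^sup>2 / \<tau>)) * ((jtheta \<sigma> (z / \<tau>) / (z / \<tau>)) / \<tau>)) \<longlongrightarrow>
        exp (- (of_real pi * \<i> * 0\<^sup>2 / \<tau>)) * ((- 2 * of_real pi * \<i> * qp (qpow \<sigma> 1) (qpow \<sigma> 1) ^ 2) / \<tau>)) (at 0)"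
      using tau0 by (intro tendsto_intros) auto
    thus ?thesis
      using tau0 by (simp add: h_def)
  qed
  \<comment> \<open>Filling in the same value \<open>K\<close> at all zeros keeps \<open>R\<close>
    doubly periodic, so that the singularity has to be removed at 0 only.\<close>
  define R where "R = (\<lambda>z. if jtheta \<tau> z = 0 then K else h z / jtheta \<tau> z)"
  have lim_R: "((\<lambda>z. h z / jtheta \<tau> z) \<longlongrightarrow> K) (at 0)"
  proof -
    have "((\<lambda>z. (h z / z) / (jtheta \<tau> z / z)) \<longlongrightarrow>
       (- 2 * of_real pi * \<i> * qp (qpow \<sigma> 1) (qpow \<sigma> 1) ^ 2 / \<tau>) /
       (- 2 * of_real pi * \<i> * qp (qpow \<tau> 1) (qpow \<tau> 1) ^ 2)) (at 0)"
      using nz by (intro tendsto_divide lim_h jtheta_limit_0 tau) auto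
    also have "(- 2 * of_real pi * \<i> * qp (qpow \<sigma> 1) (qpow \<sigma> 1) ^ 2 / \<tau>) /
       (- 2 * of_real pi * \<i> * qp (qpow \<tau> 1) (qpow \<tau> 1) ^ 2) = K"
      using nz tau0 by (simp add: K_def \<sigma>_def field_simps)
    finally show ?thesis
      by (rule Lim_transform_eventually) (auto simp: eventually_at_filter)
  qed
  have R1: "R (z + 1) = R z" and R2: "R (z + \<tau>) = R z" for z
    by (simp_all add: R_def h1 h2 jtheta_add_1 jtheta_add_tau[OF tau])
  have R_lattice: "R (z + (of_int m + of_int n * \<tau>)) = R z" for z m n
    using periodic_of_int_mult[of R 1 z m] periodic_of_int_mult[of R \<tau> "z + of_int m" n] R1 R2
    by (simp add: add_ac)
  have "\<forall>\<^sub>F z in at 0. jtheta \<tau> z / z \<noteq> 0"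
    using nz by (intro tendsto_imp_eventually_ne[OF jtheta_limit_0[OF tau]]) auto
  then obtain d where d: "d > 0" "\<And>z. z \<in> ball 0 d - {0} \<Longrightarrow> jtheta \<tau> z \<noteq> 0"
    unfolding eventually_at by (auto simp: dist_commute)
  have R_0: "R holomorphic_on ball 0 d"
  proof -
    have "(\<lambda>z. h z / jtheta \<tau> z) holomorphic_on ball 0 d - {0}"
      using d by (intro holomorphic_on_divide hol_h hol_th) auto
    hence "(\<lambda>z. if z = 0 then K else h z / jtheta \<tau> z) holomorphic_on ball 0 d"
      by (rule removable_singularity[OF _ _ lim_R]) auto
    also have "?this \<longleftrightarrow> R holomorphic_on ball 0 d"
      using d tau by (intro holomorphic_cong) (auto simp: R_def)
    finally show ?thesis .
  qed
  have "R field_differentiable (at z)" for z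
  proof (cases "jtheta \<tau> z = 0")
    case False
    have "continuous_on UNIV (jtheta \<tau>)"
      using hol_th holomorphic_on_imp_continuous_on open_UNIV by blast
    hence op: "open {z. jtheta \<tau> z \<noteq> 0}"
      by (intro open_Collect_neq continuous_intros)
    have "(\<lambda>z. h z / jtheta \<tau> z) holomorphic_on {z. jtheta \<tau> z \<noteq> 0}"
      by (intro holomorphic_on_divide hol_h hol_th op) auto
    also have "?this \<longleftrightarrow> R holomorphic_on {z. jtheta \<tau> z \<noteq> 0}"
      by (intro holomorphic_cong) (auto simp: R_def)
    finally show ?thesis
      using False op holomorphic_on_imp_differentiable_at by blast
  next
    case True
    then obtain m n where z: "z = of_int m + of_int n * \<tau>"
      using jtheta_eq_0D[OF tau] by metis
    \<comment> \<open>Near the lattice point \<open>z\<close> the function \<open>R\<close> is a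
      translate of its restriction to the disc around 0.\<close>
    have "(\<lambda>w. R (w - z)) holomorphic_on ball z d"
    proof (rule holomorphic_on_compose_gen[unfolded o_def, of "\<lambda>w. w - z" _ R])
      show "(\<lambda>w. w - z) ` ball z d \<subseteq> ball 0 d"
        by (auto simp: dist_norm norm_minus_commute)
    qed (intro holomorphic_intros R_0)+
    also have "(\<lambda>w. R (w - z)) = R"
    proof
      fix w show "R (w - z) = R w"
        using R_lattice[of "w - z" m n] by (simp add: z [symmetric])
    qed
    finally show ?thesis
      using holomorphic_on_imp_differentiable_at[of R "ball z d" z] d(1) by simp
  qed
  hence "R holomorphic_on UNIV"
    by (simp add: holomorphic_on_def field_differentiable_at_within)
  from doubly_periodic_entire_const[OF this tau R1 R2, of z]
  have "R z = K"
    using tau by (simp add: R_def)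
  hence "h z = K * jtheta \<tau> z"
  proof (cases "jtheta \<tau> z = 0")
    case True
    then obtain m n where z: "z = of_int m + of_int n * \<tau>"
      using jtheta_eq_0D[OF tau] by metis
    \<comment> \<open>The quotient gives no information at a zero of \<open>jtheta \<tau>\<close>;
      there \<open>h\<close> vanishes because it vanishes at 0 and its zero set is invariant under
      the lattice.\<close>
    have "jtheta \<sigma> (z / \<tau>) = 0"
    proof -
      have "(h (w + 1) = 0) = (h w = 0)" and "(h (w + \<tau>) = 0) = (h w = 0)" for w
        by (simp_all add: h1 h2)
      hence 1: "(h (w + of_int m) = 0) = (h w = 0)" and 2: "(h (w + of_int n * \<tau>) = 0) = (h w = 0)" for w
        using periodic_of_int_mult[of "\<lambda>w. h w = 0" 1 w m] periodic_of_int_mult[of "\<lambda>w. h w = 0" \<tau> w n]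
        by simp_all
      have "h 0 = 0" by (simp add: h_def sigma)
      hence "h z = 0"
        using 1[of 0] 2[of "of_int m"] by (simp add: z)
      thus ?thesis by (simp add: h_def)
    qed
    thus ?thesis using True by (simp add: h_def)
  qed (simp add: R_def field_simps)
  thus ?thesis
    by (simp add: h_def \<sigma>_def)
qed

text \<open>At each half period the two infinite products combine to the square of one, with
  parameter \<open>-q\<close>, \<open>p\<close> or \<open>-p\<close>, where \<open>p\<close> is a
  square root of \<open>q\<close>. Euler's identity makes the product of these three squares equal
  to 1.\<close>

lemma jtheta_half_periods:
  assumes tau: "Im \<tau> > 0"
  shows "jtheta \<tau> (1/2) * jtheta \<tau> (\<tau>/2) * jtheta \<tau> ((1 + \<tau>)/2) = -2 * exp (- (of_real pi * \<i> * \<tau>))"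
proof -
  define q where "q = qpow \<tau> 1"
  define p where "p = exp (of_real pi * \<i> * \<tau>)"
  have q: "norm q < 1"
    using norm_qpow_less_1[OF tau, of 1] by (auto simp: q_def)
  have qp: "q = p\<^sup>2" and p0: "p \<noteq> 0"
    by (simp_all add: q_def p_def qpow_def exp_double [symmetric] mult_ac)
  have e1: "exp (- (of_real pi * \<i> / 2)) = - \<i>"
    using cis_minus_pi_half by (simp add: cis_conv_exp mult_ac)
  have e2: "exp (- (of_real pi * \<i> * ((1 + \<tau>) / 2))) = exp (- (of_real pi * \<i> / 2)) * exp (- (of_real pi * \<i> * \<tau> / 2))"
    unfolding exp_add [symmetric] by (rule arg_cong[of _ _ exp]) (simp add: field_simps)
  have e3: "exp (2 * of_real pi * \<i> * ((1 + \<tau>) / 2)) = - p"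
  proof -
    have "2 * of_real pi * \<i> * ((1 + \<tau>) / 2) = of_real pi * \<i> + of_real pi * \<i> * \<tau>"
      by (simp add: algebra_simps)
    thus ?thesis unfolding p_def by (metis exp_add exp_pi_i mult_minus1)
  qed
  have e4: "exp (- (2 * of_real pi * \<i> * ((1 + \<tau>) / 2))) = - inverse p"
    using e3 by (simp add: exp_minus)
  have e5: "exp (2 * of_real pi * \<i> * (\<tau> / 2)) = p"
    by (simp add: p_def mult_ac)
  have e6: "exp (- (2 * of_real pi * \<i> * (\<tau> / 2))) = inverse p"
    using e5 by (simp add: exp_minus)
  have e7: "exp (2 * of_real pi * \<i> * (1 / 2)) = -1" "exp (- (2 * of_real pi * \<i> * (1 / 2))) = -1"
    by (simp_all add: exp_minus)
  have e8: "exp (- (of_real pi * \<i> * (1 / 2))) = - \<i>"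
    using e1 by simp
  have qi: "q * inverse p = p" "q * - inverse p = - p"
    using p0 by (simp_all add: qp power2_eq_square)
  have h1: "jtheta \<tau> (1/2) = - 2 * \<i> * qp (-q) q ^ 2"
    using qp_shift[OF q, of "-1"]
    unfolding jtheta_def e7 e8 q_def [symmetric] by (simp add: power2_eq_square)
  have h2: "jtheta \<tau> (\<tau>/2) = exp (- (of_real pi * \<i> * \<tau> / 2)) * qp p q ^ 2"
    unfolding jtheta_def e5 e6 q_def [symmetric] qi by (simp add: power2_eq_square)
  have h3: "jtheta \<tau> ((1 + \<tau>)/2) = - \<i> * exp (- (of_real pi * \<i> * \<tau> / 2)) * qp (-p) q ^ 2"
    unfolding jtheta_def e2 e3 e4 q_def [symmetric] qi e1 by (simp add: power2_eq_square)
  have "qp (-q) q * (qp p q * qp (-p) q) = 1"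
    unfolding qp_mult_minus[OF q] using qp_euler[OF q] by (simp add: qp)
  hence "(qp (-q) q * (qp p q * qp (-p) q)) ^ 2 = 1"
    by simp
  hence X: "qp (-q) q ^ 2 * qp p q ^ 2 * qp (-p) q ^ 2 = 1"
    by (simp add: power_mult_distrib mult_ac)
  have Y: "exp (- (of_real pi * \<i> * \<tau> / 2)) * exp (- (of_real pi * \<i> * \<tau> / 2)) = exp (- (of_real pi * \<i> * \<tau>))"
    by (simp add: exp_add [symmetric] mult_ac)
  have "jtheta \<tau> (1/2) * jtheta \<tau> (\<tau>/2) * jtheta \<tau> ((1 + \<tau>)/2) =
      (2 * \<i> * \<i>) * (exp (- (of_real pi * \<i> * \<tau> / 2)) * exp (- (of_real pi * \<i> * \<tau> / 2))) *
      (qp (-q) q ^ 2 * qp p q ^ 2 * qp (-p) q ^ 2)"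
    unfolding h1 h2 h3 by (simp only: mult_ac minus_mult_left [symmetric] minus_mult_right [symmetric] minus_minus)
  thus ?thesis
    unfolding X Y by simp
qed

section \<open>The square of the eta function and its inversion formula\<close>

text \<open>This is \<open>\<eta>(\<tau>)\<^sup>2\<close> for the Dedekind eta function \<open>\<eta>\<close>.\<close>

definition eta2 :: "complex \<Rightarrow> complex" where
  "eta2 \<tau> = qpow \<tau> (1/12) * qp (qpow \<tau> 1) (qpow \<tau> 1) ^ 2"

lemma eta2_nonzero: "Im \<tau> > 0 \<Longrightarrow> eta2 \<tau> \<noteq> 0"
  using qp_same_nonzero[OF norm_qpow_less_1[of \<tau> 1]] by (simp add: eta2_def)

lemma open_upper_half_plane: "open {\<tau>. Im \<tau> > 0}"
  by (rule open_halfspace_Im_gt)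

lemma connected_upper_half_plane: "connected {\<tau>. Im \<tau> > 0}"
  by (intro convex_connected convex_halfspace_Im_gt)

lemma eta2_holomorphic:
  assumes "f holomorphic_on A" and "open A" and "\<And>z. z \<in> A \<Longrightarrow> Im (f z) > 0"
  shows "(\<lambda>z. eta2 (f z)) holomorphic_on A"
  unfolding eta2_def using assms
  by (intro holomorphic_intros norm_qpow_less_1) auto

lemma eta2_add_1: "eta2 (\<tau> + 1) = cis (pi / 6) * eta2 \<tau>"
proof -
  have "qpow (\<tau> + 1) 1 = qpow \<tau> 1"
    by (simp add: qpow_def distrib_left exp_add)
  moreover have "qpow (\<tau> + 1) (1/12) = cis (pi / 6) * qpow \<tau> (1/12)"
    by (simp add: qpow_def cis_conv_exp exp_add [symmetric] algebra_simps add_divide_distrib)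
  ultimately show ?thesis
    by (simp add: eta2_def)
qed

text \<open>Inversion permutes the three half periods modulo the lattice. Multiplying the three
  instances of the theta transformation thus leaves on both sides the products known from
  \<open>jtheta_half_periods\<close>, which determines \<open>K ^ 3\<close>; the ratio of the eta
  squares is \<open>K\<close> up to elementary factors.\<close>

lemma eta2_S_cubed:
  assumes tau: "Im \<tau> > 0"
  shows "eta2 (-1/\<tau>) ^ 3 = (- \<i> * \<tau>) ^ 3 * eta2 \<tau> ^ 3"
proof -
  have tau0: "\<tau> \<noteq> 0" using tau by auto
  define \<sigma> where "\<sigma> = -1 / \<tau>"
  have sigma: "Im \<sigma> > 0"
    using Im_minus_inverse_pos[OF tau] by (simp add: \<sigma>_def)
  define f where "f = qp (qpow \<tau> 1) (qpow \<tau> 1) ^ 2"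
  define g where "g = qp (qpow \<sigma> 1) (qpow \<sigma> 1) ^ 2"
  have f0: "f \<noteq> 0"
    unfolding f_def by (simp add: qp_same_nonzero norm_qpow_less_1 tau)
  define K where "K = g / (\<tau> * f)"
  have tr: "exp (- (of_real pi * \<i> * z\<^sup>2 / \<tau>)) * jtheta \<sigma> (z / \<tau>) = K * jtheta \<tau> z" for z
    using jtheta_S_transform[OF tau, of z] by (simp add: K_def f_def g_def \<sigma>_def)
  define E where "E = (\<lambda>z. exp (- (of_real pi * \<i> * z\<^sup>2 / \<tau>)))"
  have 1: "E (1/2) * - jtheta \<sigma> (\<sigma>/2) = K * jtheta \<tau> (1/2)"
  proof -
    \<comment> \<open>The argument on the left is \<open>- \<sigma>/2\<close>, one period away from
      \<open>\<sigma>/2\<close>; the exponential factor of the shift is 1 there.\<close>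
    have "jtheta \<sigma> ((1/2) / \<tau>) = - jtheta \<sigma> (\<sigma>/2)"
      using jtheta_add_tau[OF sigma, of "-\<sigma>/2"] tau0 by (simp add: \<sigma>_def field_simps)
    thus ?thesis using tr[of "1/2"] unfolding E_def by simp
  qed
  have 2: "E (\<tau>/2) * jtheta \<sigma> (1/2) = K * jtheta \<tau> (\<tau>/2)"
    using tr[of "\<tau>/2"] tau0 by (simp add: E_def)
  have 3: "E ((1 + \<tau>)/2) * jtheta \<sigma> ((1 + \<sigma>)/2) = K * jtheta \<tau> ((1 + \<tau>)/2)"
  proof -
    have 1: "\<sigma> + 2 * ((1 - \<sigma>) / 2) = 1" and 2: "(1 - \<sigma>)/2 + \<sigma> = (1 + \<sigma>)/2"
      by (simp_all add: field_simps)
    have 3: "exp (- (of_real pi * \<i> * 1)) = -1"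
      by (simp add: exp_minus)
    have "jtheta \<sigma> ((1 + \<sigma>)/2) = jtheta \<sigma> ((1 - \<sigma>)/2)"
      using jtheta_add_tau[OF sigma, of "(1 - \<sigma>)/2"] unfolding 1 2 3 by simp
    also have "(1 - \<sigma>)/2 = ((1 + \<tau>)/2) / \<tau>"
      using tau0 by (simp add: \<sigma>_def field_simps)
    finally show ?thesis
      using tr[of "(1 + \<tau>)/2"] by (simp only: E_def)
  qed
  have E: "E (1/2) * E (\<tau>/2) * E ((1 + \<tau>)/2) = - \<i> * exp (of_real pi * \<i> * \<sigma> / 2 - of_real pi * \<i> * \<tau> / 2)"
  proof -
    have "- (of_real pi * \<i> * (1/2)\<^sup>2 / \<tau>) + - (of_real pi * \<i> * (\<tau>/2)\<^sup>2 / \<tau>) + - (of_real pi * \<i> * ((1 + \<tau>)/2)\<^sup>2 / \<tau>) =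
        - (of_real pi * \<i> / 2) + (of_real pi * \<i> * \<sigma> / 2 - of_real pi * \<i> * \<tau> / 2)"
      using tau0 by (simp add: \<sigma>_def field_simps power2_eq_square)
    moreover have "exp (- (of_real pi * \<i> / 2)) = - \<i>"
      using cis_minus_pi_half by (simp add: cis_conv_exp mult_ac)
    ultimately show ?thesis
      unfolding E_def exp_add [symmetric] by (simp only: exp_add)
  qed
  have K3: "K ^ 3 = \<i> * exp (of_real pi * \<i> * \<tau> / 2 - of_real pi * \<i> * \<sigma> / 2)"
  proof -
    have "(E (1/2) * E (\<tau>/2) * E ((1 + \<tau>)/2)) * - (jtheta \<sigma> (1/2) * jtheta \<sigma> (\<sigma>/2) * jtheta \<sigma> ((1 + \<sigma>)/2)) =
        (E (1/2) * - jtheta \<sigma> (\<sigma>/2)) * (E (\<tau>/2) * jtheta \<sigma> (1/2)) * (E ((1 + \<tau>)/2) * jtheta \<sigma> ((1 + \<sigma>)/2))"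
      by (simp add: mult_ac)
    also have "\<dots> = K ^ 3 * (jtheta \<tau> (1/2) * jtheta \<tau> (\<tau>/2) * jtheta \<tau> ((1 + \<tau>)/2))"
      unfolding 1 2 3 by (simp add: power3_eq_cube mult_ac)
    finally have "K ^ 3 * exp (- (of_real pi * \<i> * \<tau>)) =
        \<i> * (exp (of_real pi * \<i> * \<sigma> / 2 - of_real pi * \<i> * \<tau> / 2) * exp (- (of_real pi * \<i> * \<sigma>)))"
      unfolding E jtheta_half_periods[OF tau] jtheta_half_periods[OF sigma] by (simp add: mult_ac)
    also have "exp (of_real pi * \<i> * \<sigma> / 2 - of_real pi * \<i> * \<tau> / 2) * exp (- (of_real pi * \<i> * \<sigma>)) =
        exp (of_real pi * \<i> * \<tau> / 2 - of_real pi * \<i> * \<sigma> / 2) * exp (- (of_real pi * \<i> * \<tau>))"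
      unfolding exp_add [symmetric] by (rule arg_cong[of _ _ exp]) (simp add: field_simps)
    finally have "K ^ 3 * exp (- (of_real pi * \<i> * \<tau>)) =
        (\<i> * exp (of_real pi * \<i> * \<tau> / 2 - of_real pi * \<i> * \<sigma> / 2)) * exp (- (of_real pi * \<i> * \<tau>))"
      by (simp only: mult.assoc)
    thus ?thesis
      by (metis exp_not_eq_zero mult_right_cancel)
  qed
  have "eta2 \<sigma> ^ 3 = qpow \<sigma> (1/4) * g ^ 3"
    by (simp add: eta2_def g_def power_mult_distrib qpow_power)
  also have "g = K * (\<tau> * f)"
    using tau0 f0 by (simp add: K_def)
  also have "qpow \<sigma> (1/4) * (K * (\<tau> * f)) ^ 3 =
      \<i> * \<tau> ^ 3 * (qpow \<sigma> (1/4) * exp (of_real pi * \<i> * \<tau> / 2 - of_real pi * \<i> * \<sigma> / 2)) * f ^ 3"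
    by (simp add: power_mult_distrib K3)
  also have "qpow \<sigma> (1/4) * exp (of_real pi * \<i> * \<tau> / 2 - of_real pi * \<i> * \<sigma> / 2) = qpow \<tau> (1/4)"
    by (simp add: qpow_def exp_add [symmetric] mult_ac)
  also have "\<i> * \<tau> ^ 3 * qpow \<tau> (1/4) * f ^ 3 = \<i> * \<tau> ^ 3 * eta2 \<tau> ^ 3"
    by (simp add: eta2_def f_def power_mult_distrib qpow_power)
  also have "\<i> * \<tau> ^ 3 = (- \<i> * \<tau>) ^ 3"
    by (simp only: power_mult_distrib) (simp add: power3_eq_cube)
  finally show ?thesis
    by (simp add: \<sigma>_def)
qed

text \<open>The quotient of both sides is holomorphic with values in the cube roots of unity, hence
  constant, and it equals 1 at the fixed point \<open>\<i>\<close>.\<close>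

lemma eta2_S:
  assumes tau: "Im \<tau> > 0"
  shows "eta2 (-1/\<tau>) = - \<i> * \<tau> * eta2 \<tau>"
proof -
  define H where "H = {\<tau>. Im \<tau> > 0}"
  define r where "r = (\<lambda>\<tau>. eta2 (-1/\<tau>) / (- \<i> * \<tau> * eta2 \<tau>))"
  have "r holomorphic_on H"
    unfolding r_def H_def using open_upper_half_plane eta2_nonzero
    by (intro holomorphic_intros eta2_holomorphic Im_minus_inverse_pos) auto
  hence cont: "continuous_on H r"
    by (rule holomorphic_on_imp_continuous_on)
  have r3: "r \<tau> ^ 3 = 1" if "Im \<tau> > 0" for \<tau>
    using eta2_S_cubed[OF that] eta2_nonzero[OF that] that
    by (auto simp: r_def power_divide power_mult_distrib)
  have "r ` H \<subseteq> {z. z ^ 3 = 1}"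
    using r3 by (auto simp: H_def)
  moreover have "finite {z::complex. z ^ 3 = 1}"
    by (rule finite_roots_unity) auto
  ultimately have "r constant_on H"
    using continuous_finite_range_constant[of H r] cont connected_upper_half_plane finite_subset
    unfolding H_def by blast
  hence "r \<tau> = r \<i>"
    unfolding constant_on_def H_def using tau by (metis mem_Collect_eq imaginary_unit.sel(2) zero_less_one)
  also have "r \<i> = 1"
    using eta2_nonzero[of \<i>] by (simp add: r_def)
  finally have "eta2 (-1/\<tau>) / (- \<i> * \<tau> * eta2 \<tau>) = 1"
    by (simp only: r_def)
  thus ?thesis
    by (simp only: divide_eq_1_iff)
qed

section \<open>Transformation under the modular group\<close>

definition zeta12 :: "int \<Rightarrow> complex" where
  "zeta12 k = cis (of_int k * pi / 6)"

lemma zeta12_add: "zeta12 (k + l) = zeta12 k * zeta12 l"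
  by (simp add: zeta12_def cis_mult algebra_simps add_divide_distrib)

lemma zeta12_cong:
  assumes "12 dvd k - l"
  shows "zeta12 k = zeta12 l"
proof -
  obtain m where "k = l + 12 * m"
    using assms by (metis dvdE diff_eq_eq add.commute)
  hence "zeta12 k = zeta12 l * cis (2 * pi * of_int m)"
    by (simp add: zeta12_def cis_mult algebra_simps add_divide_distrib)
  thus ?thesis by simp
qed

text \<open>The determinant is left free, so that the Atkin-Lehner matrix of determinant 13 is
  covered besides \<open>SL_2(Z)\<close>.\<close>

definition mob :: "int \<Rightarrow> int \<Rightarrow> int \<Rightarrow> int \<Rightarrow> complex \<Rightarrow> complex" where
  "mob a b c d \<tau> = (of_int a * \<tau> + of_int b) / (of_int c * \<tau> + of_int d)"

lemma mob_denom_nonzero: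
  assumes "a * d - b * c \<noteq> (0::int)" and "Im \<tau> > 0"
  shows "of_int c * \<tau> + of_int d \<noteq> 0"
proof
  assume *: "of_int c * \<tau> + of_int d = 0"
  hence "Im (of_int c * \<tau> + of_int d) = 0" and "Re (of_int c * \<tau> + of_int d) = 0"
    by simp_all
  with assms show False by auto
qed

lemma Im_mob:
  "Im (mob a b c d \<tau>) = of_int (a * d - b * c) * Im \<tau> / (norm (of_int c * \<tau> + of_int d))\<^sup>2"
  by (simp add: mob_def Im_divide cmod_power2 algebra_simps)

lemma Im_mob_pos:
  assumes "a * d - b * c > 0" and "Im \<tau> > 0"
  shows "Im (mob a b c d \<tau>) > 0"
proof -
  have "of_int (a * d - b * c) > (0::real)"
    using assms(1) by (simp only: of_int_0_less_iff)
  thus ?thesis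
    unfolding Im_mob using assms mob_denom_nonzero[of a d b c \<tau>]
    by (intro divide_pos_pos mult_pos_pos) auto
qed

lemma mob_mob:
  assumes "a' * d' - b' * c' \<noteq> 0" and "Im \<tau> > 0"
  shows "mob a b c d (mob a' b' c' d' \<tau>) =
    mob (a * a' + b * c') (a * b' + b * d') (c * a' + d * c') (c * b' + d * d') \<tau>"
proof -
  define w where "w = of_int c' * \<tau> + of_int d'"
  have w: "w \<noteq> 0"
    using mob_denom_nonzero[OF assms] by (simp add: w_def)
  have "mob a b c d (mob a' b' c' d' \<tau>) =
      (of_int a * (of_int a' * \<tau> + of_int b') / w + of_int b) / (of_int c * (of_int a' * \<tau> + of_int b') / w + of_int d)"
    by (simp add: mob_def w_def)
  also have "\<dots> = (of_int a * (of_int a' * \<tau> + of_int b') + of_int b * w) / (of_int c * (of_int a' * \<tau> + of_int b') + of_int d * w)"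
    using w by (simp add: divide_simps)
  finally show ?thesis
    by (simp add: mob_def w_def algebra_simps)
qed

text \<open>Conjugation by \<open>diag(n, 1)\<close>. It lets \<open>eta2_mob\<close> be applied to
  \<open>eta2 (n * \<tau>)\<close> under matrices whose lower left entry is divisible by
  \<open>n\<close>.\<close>

lemma mob_scale: "of_int n * mob a b (n * c) d \<tau> = mob a (n * b) c d (of_int n * \<tau>)"
  by (simp add: mob_def algebra_simps)

text \<open>The group \<open>SL\<^sub>2(\<int>)\<close> is generated by translations and the inversion: Euclid's algorithm
  on the lower row.\<close>

lemma SL2_induct [consumes 1, case_names base translate invert]:
  fixes a b c d :: int
  assumes det: "a * d - b * c = 1"
    and base: "\<And>e b. e * e = 1 \<Longrightarrow> V e b 0 e"
    and trans: "\<And>a b c d k. a * d - b * c = 1 \<Longrightarrow> V a (b + k * a) c (d + k * c) \<Longrightarrow> V a b c d"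
    and inv: "\<And>a b c d. a * d - b * c = 1 \<Longrightarrow> V b (-a) d (-c) \<Longrightarrow> V a b c d"
  shows "V a b c d"
  using det
proof (induction "nat \<bar>c\<bar>" arbitrary: a b c d rule: less_induct)
  case less
  show ?case
  proof (cases "c = 0")
    case True
    with less.prems have "a * d = 1" by simp
    hence "a = d" "a * a = 1"
      by (auto simp: zmult_eq_1_iff)
    thus ?thesis using base True by auto
  next
    case False
    define k where "k = - (d div c)"
    define b' where "b' = b + k * a"
    define d' where "d' = d + k * c"
    have "d' = d mod c"
      by (simp add: d'_def k_def minus_div_mult_eq_mod)
    hence "nat \<bar>d'\<bar> < nat \<bar>c\<bar>"
      using abs_mod_less[OF False, of d] by simp
    moreover have det': "a * d' - b' * c = 1"
      using less.prems by (simp add: b'_def d'_def algebra_simps)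
    ultimately have "V b' (- a) d' (- c)"
      by (intro less.hyps) (auto simp: algebra_simps)
    hence "V a b' c d'"
      by (rule inv[OF det'])
    thus ?thesis
      unfolding b'_def d'_def by (rule trans[OF less.prems])
  qed
qed

text \<open>Modulo 12 this is the homomorphism from \<open>SL\<^sub>2(\<int>)\<close> to its abelianization \<open>\<int>/12\<close>, written as a
  polynomial in the matrix entries; it gives the multiplier system of \<open>\<eta>\<^sup>2\<close>.\<close>

definition eta2_phase :: "int \<Rightarrow> int \<Rightarrow> int \<Rightarrow> int \<Rightarrow> int" where
  "eta2_phase a b c d = (1 - c\<^sup>2) * (b * d + 3 * (c - 1) * d + c + 3) + c * (a + d - 3)"

text \<open>Divisibility by 12 splits into 3 and 4, and as \<open>p\<close> and \<open>r\<close>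
  depend only on residues, 81 and 256 cases remain, which can be evaluated. In the applications
  \<open>r = 0\<close> is the determinant condition.\<close>

lemma dvd_12_by_residues:
  fixes p r :: "int \<Rightarrow> int \<Rightarrow> int \<Rightarrow> int \<Rightarrow> int"
  assumes p: "\<And>m a b c d. p a b c d mod m = p (a mod m) (b mod m) (c mod m) (d mod m) mod m"
    and r: "\<And>m a b c d. r a b c d mod m = r (a mod m) (b mod m) (c mod m) (d mod m) mod m"
    and mod3: "\<forall>a\<in>{0,1,2}. \<forall>b\<in>{0,1,2}. \<forall>c\<in>{0,1,2}. \<forall>d\<in>{0,1,2}. 
      r a b c d mod 3 = 0 \<longrightarrow> p a b c d mod 3 = 0"
    and mod4: "\<forall>a\<in>{0,1,2,3}. \<forall>b\<in>{0,1,2,3}. \<forall>c\<in>{0,1,2,3}. \<forall>d\<in>{0,1,2,3}.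
      r a b c d mod 4 = 0 \<longrightarrow> p a b c d mod 4 = 0"
    and "r a b c d = 0"
  shows "12 dvd p a b c d"
proof -
  have m3: "x mod 3 \<in> {0,1,2}" and m4: "x mod 4 \<in> {0,1,2,3}" for x :: int
    by auto
  have "p a b c d mod 3 = 0"
    using mod3 m3[of a] m3[of b] m3[of c] m3[of d] p[of a b c d 3] r[of a b c d 3] \<open>r a b c d = 0\<close>
    by (metis mod_0)
  moreover have "p a b c d mod 4 = 0"
    using mod4 m4[of a] m4[of b] m4[of c] m4[of d] p[of a b c d 4] r[of a b c d 4] \<open>r a b c d = 0\<close>
    by (metis mod_0)
  ultimately show ?thesis
    by presburger
qed

text \<open>The increment 1 matches the factor \<open>cis (pi / 6) = zeta12 1\<close> of
  \<open>eta2_add_1\<close>.\<close>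

lemma eta2_phase_translate:
  assumes "a * d - b * c = 1"
  shows "12 dvd eta2_phase a (b + a) c (d + c) - (eta2_phase a b c d + 1)"
proof (rule dvd_12_by_residues[of "\<lambda>a b c d. eta2_phase a (b + a) c (d + c) - (eta2_phase a b c d + 1)"
    "\<lambda>a b c d. a * d - b * c - 1"])
qed ((unfold eta2_phase_def power2_eq_square)?,
    (intro mod_add_cong mod_diff_cong mod_mult_cong mod_minus_cong; simp) | code_simp | use assms in simp)+

text \<open>The shift by -3 contributes \<open>zeta12 (-3) = - \<i>\<close>. Together with the
  \<open>- \<i>\<close> of \<open>eta2_S\<close> it makes up for the sign in
  \<open>(d \<sigma> - c) \<tau> = - (c \<tau> + d)\<close>, where
  \<open>\<sigma> = -1 / \<tau>\<close>.\<close>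

lemma eta2_phase_invert:
  assumes "a * d - b * c = 1"
  shows "12 dvd eta2_phase b (- a) d (- c) - (eta2_phase a b c d - 3)"
proof (rule dvd_12_by_residues[of "\<lambda>a b c d. eta2_phase b (- a) d (- c) - (eta2_phase a b c d - 3)"
    "\<lambda>a b c d. a * d - b * c - 1"])
qed ((unfold eta2_phase_def power2_eq_square)?,
    (intro mod_add_cong mod_diff_cong mod_mult_cong mod_minus_cong; simp) | code_simp | use assms in simp)+

lemma zeta12_values: "zeta12 6 = -1" "zeta12 (-3) = - \<i>" "zeta12 1 = cis (pi / 6)"
  by (simp_all add: zeta12_def complex_eq_iff)

lemma zeta12_0 [simp]: "zeta12 0 = 1"
  by (simp add: zeta12_def)

lemma zeta12_nonzero [simp]: "zeta12 k \<noteq> 0"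
  by (simp add: zeta12_def)

lemma eta2_add_int: "eta2 (\<tau> + of_int k) = zeta12 k * eta2 \<tau>"
proof (induction k arbitrary: \<tau> rule: int_induct[of _ 0])
  case (step1 i)
  have "eta2 (\<tau> + of_int (i + 1)) = eta2 ((\<tau> + of_int i) + 1)"
    by (simp add: add_ac)
  thus ?case
    using step1 by (simp add: eta2_add_1 zeta12_add zeta12_values)
next
  case (step2 i)
  have "zeta12 1 * eta2 (\<tau> + of_int (i - 1)) = eta2 (\<tau> + of_int i)"
    using eta2_add_1[of "\<tau> + of_int (i - 1)"] by (simp add: zeta12_values)
  also have "\<dots> = zeta12 1 * (zeta12 (i - 1) * eta2 \<tau>)"
    using step2 zeta12_add[of 1 "i - 1"] by simp
  finally show ?case
    by (metis mult_cancel_left zeta12_nonzero)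
qed simp

lemma eta2_phase_translate_int:
  assumes "a * d - b * c = 1"
  shows "12 dvd eta2_phase a (b + k * a) c (d + k * c) - (eta2_phase a b c d + k)"
proof (induction k rule: int_induct[of _ 0])
  case (step1 i)
  have "12 dvd eta2_phase a (b + i * a + a) c (d + i * c + c) - (eta2_phase a (b + i * a) c (d + i * c) + 1)"
    using assms by (intro eta2_phase_translate) (simp add: algebra_simps)
  from dvd_add[OF step1(2) this] show ?case
    by (simp add: algebra_simps)
next
  case (step2 i)
  have "12 dvd eta2_phase a (b + (i - 1) * a + a) c (d + (i - 1) * c + c) -
      (eta2_phase a (b + (i - 1) * a) c (d + (i - 1) * c) + 1)"
    using assms by (intro eta2_phase_translate) (simp add: algebra_simps)
  from dvd_diff[OF step2(2) this] show ?case
    by (simp add: algebra_simps)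
qed simp

text \<open>Induction over the generators: the formula is passed along translations by
  \<open>eta2_add_int\<close> and along the inversion by \<open>eta2_S\<close>, and the two
  congruences for \<open>eta2_phase\<close> keep the multiplier in step.\<close>

theorem eta2_mob:
  assumes "a * d - b * c = 1" and "Im \<tau> > 0"
  shows "eta2 (mob a b c d \<tau>) = zeta12 (eta2_phase a b c d) * (of_int c * \<tau> + of_int d) * eta2 \<tau>"
  using assms
proof (induction a b c d arbitrary: \<tau> rule: SL2_induct)
  case (base e b)
  hence "e = 1 \<or> e = -1"
    by (metis zmult_eq_1_iff)
  thus ?case
  proof
    assume "e = 1"
    thus ?thesis
      using eta2_add_int[of \<tau> b] zeta12_cong[of "eta2_phase 1 b 0 1" b]
      by (simp add: mob_def eta2_phase_def)
  next
    assume e: "e = -1"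
    \<comment> \<open>Here \<open>eta2_phase (-1) b 0 (-1)\<close> is \<open>6 - b\<close>, and the
      6 cancels the sign of the denominator \<open>d = -1\<close>.\<close>
    have "zeta12 (6 - b) = - zeta12 (- b)"
      using zeta12_add[of 6 "- b"] by (simp add: zeta12_values)
    thus ?thesis
      using eta2_add_int[of \<tau> "- b"] e
      by (simp add: mob_def eta2_phase_def)
  qed
next
  case (translate a b c d k)
  define \<sigma> where "\<sigma> = \<tau> - of_int k"
  have sigma: "Im \<sigma> > 0" and tau: "\<tau> = \<sigma> + of_int k"
    using translate.prems by (simp_all add: \<sigma>_def)
  have "mob a b c d \<tau> = mob a (b + k * a) c (d + k * c) \<sigma>"
    by (simp add: mob_def \<sigma>_def algebra_simps)
  also have "eta2 \<dots> = zeta12 (eta2_phase a (b + k * a) c (d + k * c)) *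
      (of_int c * \<sigma> + of_int (d + k * c)) * eta2 \<sigma>"
    by (rule translate.IH[OF sigma])
  also have "zeta12 (eta2_phase a (b + k * a) c (d + k * c)) = zeta12 (eta2_phase a b c d) * zeta12 k"
    using zeta12_cong[OF eta2_phase_translate_int[OF translate.hyps]] by (simp add: zeta12_add)
  also have "of_int c * \<sigma> + of_int (d + k * c) = of_int c * \<tau> + of_int d"
    by (simp add: \<sigma>_def algebra_simps)
  finally show ?case
    using eta2_add_int[of \<sigma> k] by (simp add: tau)
next
  case (invert a b c d)
  define \<sigma> where "\<sigma> = -1 / \<tau>"
  have sigma: "Im \<sigma> > 0" and tau: "\<tau> = -1 / \<sigma>" and tau0: "\<tau> \<noteq> 0"
    using Im_minus_inverse_pos[OF invert.prems] invert.prems by (auto simp: \<sigma>_def)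
  have "of_int b * \<sigma> + of_int (-a) = - ((of_int a * \<tau> + of_int b) / \<tau>)"
    and "of_int d * \<sigma> + of_int (-c) = - ((of_int c * \<tau> + of_int d) / \<tau>)"
    using tau0 by (simp_all add: \<sigma>_def field_simps)
  hence "mob b (-a) d (-c) \<sigma> = - ((of_int a * \<tau> + of_int b) / \<tau>) / - ((of_int c * \<tau> + of_int d) / \<tau>)"
    by (simp only: mob_def)
  also have "\<dots> = mob a b c d \<tau>"
    using tau0 by (simp only: minus_divide_divide) (simp add: mob_def)
  finally have "mob a b c d \<tau> = mob b (-a) d (-c) \<sigma>" ..
  also have "eta2 \<dots> = zeta12 (eta2_phase b (-a) d (-c)) * (of_int d * \<sigma> + of_int (-c)) * eta2 \<sigma>"
    by (rule invert.IH[OF sigma])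
  also have "zeta12 (eta2_phase b (-a) d (-c)) = zeta12 (eta2_phase a b c d) * (- \<i>)"
    using zeta12_cong[OF eta2_phase_invert[OF invert.hyps]] zeta12_add[of "eta2_phase a b c d" "-3"]
    by (simp add: zeta12_values)
  also have "eta2 \<sigma> = - \<i> * \<tau> * eta2 \<tau>"
    using eta2_S[OF invert.prems] by (simp add: \<sigma>_def)
  also have "zeta12 (eta2_phase a b c d) * (- \<i>) * (of_int d * \<sigma> + of_int (- c)) * (- \<i> * \<tau> * eta2 \<tau>) =
      zeta12 (eta2_phase a b c d) * - ((of_int d * \<sigma> - of_int c) * \<tau>) * eta2 \<tau>"
  proof -
    have "z * (- \<i>) * x * (- \<i> * \<tau> * e) = z * - (x * \<tau>) * e" for x z e
      by (simp add: mult_ac)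
    thus ?thesis by simp
  qed
  also have "- ((of_int d * \<sigma> - of_int c) * \<tau>) = of_int c * \<tau> + of_int d"
    using tau0 by (simp add: \<sigma>_def algebra_simps)
  finally show ?case .
qed

section \<open>Eta quotients of level 26\<close>

definition etaA :: "complex \<Rightarrow> complex" where
  "etaA \<tau> = eta2 (2 * \<tau>) ^ 3 * eta2 (13 * \<tau>) / (eta2 \<tau> * eta2 (26 * \<tau>) ^ 3)"

definition etaC :: "complex \<Rightarrow> complex" where
  "etaC \<tau> = eta2 (2 * \<tau>) / eta2 (26 * \<tau>)"

text \<open>Numerators and denominators have equally many eta factors, so the powers of
  \<open>j\<close> cancel. The multipliers cancel because those at 2 and 26 agree, and likewise
  those at 1 and 13.\<close>

lemma etaA_etaC_invariant:
  assumes det: "a * d - b * (26 * c) = 1" and tau: "Im \<tau> > 0"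
  shows "etaA (mob a b (26 * c) d \<tau>) = etaA \<tau>" "etaC (mob a b (26 * c) d \<tau>) = etaC \<tau>"
proof -
  define \<gamma> where "\<gamma> = mob a b (26 * c) d \<tau>"
  define j where "j = 26 * of_int c * \<tau> + of_int d"
  have j: "j \<noteq> 0"
    using mob_denom_nonzero[of a d b "26 * c" \<tau>] assms by (simp add: j_def)
  have e1: "eta2 \<gamma> = zeta12 (eta2_phase a b (26 * c) d) * j * eta2 \<tau>"
    using eta2_mob[of a d b "26 * c" \<tau>] assms by (simp add: \<gamma>_def j_def)
  have e2: "eta2 (2 * \<gamma>) = zeta12 (eta2_phase a (2 * b) (13 * c) d) * j * eta2 (2 * \<tau>)"
    using eta2_mob[of a d "2 * b" "13 * c" "2 * \<tau>"] mob_scale[of 2 a b "13 * c" d \<tau>] assms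
    by (simp add: \<gamma>_def j_def mult_ac)
  have e13: "eta2 (13 * \<gamma>) = zeta12 (eta2_phase a (13 * b) (2 * c) d) * j * eta2 (13 * \<tau>)"
    using eta2_mob[of a d "13 * b" "2 * c" "13 * \<tau>"] mob_scale[of 13 a b "2 * c" d \<tau>] assms
    by (simp add: \<gamma>_def j_def mult_ac)
  have e26: "eta2 (26 * \<gamma>) = zeta12 (eta2_phase a (26 * b) c d) * j * eta2 (26 * \<tau>)"
    using eta2_mob[of a d "26 * b" c "26 * \<tau>"] mob_scale[of 26 a b c d \<tau>] assms
    by (simp add: \<gamma>_def j_def mult_ac)
  have "12 dvd eta2_phase a (2 * b) (13 * c) d - eta2_phase a (26 * b) c d"
  proof (rule dvd_12_by_residues[of "\<lambda>a b c d. eta2_phase a (2 * b) (13 * c) d - eta2_phase a (26 * b) c d"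
      "\<lambda>a b c d. a * d - b * (26 * c) - 1"])
  qed ((unfold eta2_phase_def power2_eq_square)?,
    (intro mod_add_cong mod_diff_cong mod_mult_cong mod_minus_cong; simp) | code_simp | use assms in simp)+
  hence z1: "zeta12 (eta2_phase a (2 * b) (13 * c) d) = zeta12 (eta2_phase a (26 * b) c d)"
    by (rule zeta12_cong)
  have "12 dvd eta2_phase a (13 * b) (2 * c) d - eta2_phase a b (26 * c) d"
  proof (rule dvd_12_by_residues[of "\<lambda>a b c d. eta2_phase a (13 * b) (2 * c) d - eta2_phase a b (26 * c) d"
      "\<lambda>a b c d. a * d - b * (26 * c) - 1"])
  qed ((unfold eta2_phase_def power2_eq_square)?,
    (intro mod_add_cong mod_diff_cong mod_mult_cong mod_minus_cong; simp) | code_simp | use assms in simp)+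
  hence z2: "zeta12 (eta2_phase a (13 * b) (2 * c) d) = zeta12 (eta2_phase a b (26 * c) d)"
    by (rule zeta12_cong)
  show "etaC (mob a b (26 * c) d \<tau>) = etaC \<tau>"
    unfolding etaC_def \<gamma>_def [symmetric] e2 e26 z1 using j by simp
  show "etaA (mob a b (26 * c) d \<tau>) = etaA \<tau>"
    unfolding etaA_def \<gamma>_def [symmetric] e1 e2 e13 e26 z1 z2 using j by (simp add: power_mult_distrib)
qed

text \<open>The matrix is an Atkin-Lehner involution of determinant 13.\<close>

lemma etaA_etaC_atkin_lehner:
  assumes tau: "Im \<tau> > 0"
  shows "etaA (mob 13 6 26 13 \<tau>) = 169 / etaA \<tau>" "etaC (mob 13 6 26 13 \<tau>) = 13 / etaC \<tau>"
proof -
  define \<gamma> where "\<gamma> = mob 13 6 26 13 \<tau>"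
  define j where "j = 2 * \<tau> + 1"
  have j: "j \<noteq> 0"
    using mob_denom_nonzero[of 1 1 0 2 \<tau>] assms by (simp add: j_def)
  \<comment> \<open>The involution exchanges the arguments \<open>\<tau>\<close> and
    \<open>13 * \<tau>\<close>, and also \<open>2 * \<tau>\<close> and \<open>26 * \<tau>\<close>.
    The factors 13 that remain in \<open>e1\<close> and \<open>e2\<close> produce the constants 169
    and 13.\<close>
  have "\<gamma> = mob 1 6 2 13 (13 * \<tau>)"
    by (simp add: \<gamma>_def mob_def)
  hence e1: "eta2 \<gamma> = zeta12 (eta2_phase 1 6 2 13) * (13 * j) * eta2 (13 * \<tau>)"
    using eta2_mob[of 1 13 6 2 "13 * \<tau>"] tau by (simp add: j_def)
  have "2 * \<gamma> = mob 1 12 1 13 (26 * \<tau>)"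
    by (simp add: \<gamma>_def mob_def)
  hence e2: "eta2 (2 * \<gamma>) = zeta12 (eta2_phase 1 12 1 13) * (13 * j) * eta2 (26 * \<tau>)"
    using eta2_mob[of 1 13 12 1 "26 * \<tau>"] tau by (simp add: j_def)
  have "13 * \<gamma> = 13 * (13 * \<tau> + 6) / (13 * j)"
    by (simp add: \<gamma>_def mob_def j_def)
  also have "\<dots> = mob 13 6 2 1 \<tau>"
    by (subst mult_divide_mult_cancel_left) (simp_all add: mob_def j_def)
  finally have e13: "eta2 (13 * \<gamma>) = zeta12 (eta2_phase 13 6 2 1) * j * eta2 \<tau>"
    using eta2_mob[of 13 1 6 2 "\<tau>"] tau by (simp add: j_def)
  have "26 * \<gamma> = 13 * (26 * \<tau> + 12) / (13 * j)"
    by (simp add: \<gamma>_def mob_def j_def)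
  also have "\<dots> = mob 13 12 1 1 (2 * \<tau>)"
    by (subst mult_divide_mult_cancel_left) (simp_all add: mob_def j_def)
  finally have e26: "eta2 (26 * \<gamma>) = zeta12 (eta2_phase 13 12 1 1) * j * eta2 (2 * \<tau>)"
    using eta2_mob[of 13 1 12 1 "2 * \<tau>"] tau by (simp add: j_def)
  have z1: "zeta12 (eta2_phase 1 12 1 13) = zeta12 (eta2_phase 13 12 1 1)"
    and z2: "zeta12 (eta2_phase 13 6 2 1) = zeta12 (eta2_phase 1 6 2 13)"
    by (rule zeta12_cong, simp add: eta2_phase_def)+
  show "etaC (mob 13 6 26 13 \<tau>) = 13 / etaC \<tau>"
    unfolding etaC_def \<gamma>_def [symmetric] e2 e26 z1 using j by simp
  show "etaA (mob 13 6 26 13 \<tau>) = 169 / etaA \<tau>"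
    unfolding etaA_def \<gamma>_def [symmetric] e1 e2 e13 e26 z1 z2 using j by (simp add: power_mult_distrib)
qed

section \<open>Functions with a finite modular orbit\<close>

text \<open>Neighbourhoods of the cusp infinity, with unrestricted real part. The other cusps are
  reached by composing with \<open>mob\<close>.\<close>

definition at_cusp :: "complex filter" where
  "at_cusp = filtercomap Im at_top"

lemma eventually_at_cusp: "eventually P at_cusp \<longleftrightarrow> (\<exists>Y. \<forall>\<tau>. Im \<tau> > Y \<longrightarrow> P \<tau>)"
  unfolding at_cusp_def eventually_filtercomap eventually_at_top_dense by blast

text \<open>The value 0 off the upper half plane makes translates that agree on the half plane equal
  as functions, so that finiteness of the set is meaningful.\<close>

definition SL2_orbit :: "(complex \<Rightarrow> complex) \<Rightarrow> (complex \<Rightarrow> complex) set" where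
  "SL2_orbit F = {\<lambda>\<tau>. if Im \<tau> > 0 then F (mob a b c d \<tau>) else 0 |a b c d. a * d - b * c = 1}"

lemma SL2_orbitE:
  assumes "f \<in> SL2_orbit F"
  obtains a b c d where "a * d - b * c = 1" "f = (\<lambda>\<tau>. if Im \<tau> > 0 then F (mob a b c d \<tau>) else 0)"
  using assms unfolding SL2_orbit_def by blast

lemma mob_holomorphic:
  assumes "a * d - b * c \<noteq> 0"
  shows "mob a b c d holomorphic_on {\<tau>. Im \<tau> > 0}"
  unfolding mob_def using mob_denom_nonzero[OF assms] by (intro holomorphic_intros) auto

lemma SL2_orbit_holomorphic:
  assumes "f \<in> SL2_orbit F" and F: "F holomorphic_on {\<tau>. Im \<tau> > 0}"
  shows "f holomorphic_on {\<tau>. Im \<tau> > 0}"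
proof -
  obtain a b c d where *: "a * d - b * c = 1" "f = (\<lambda>\<tau>. if Im \<tau> > 0 then F (mob a b c d \<tau>) else 0)"
    using assms(1) by (rule SL2_orbitE)
  have "(F \<circ> mob a b c d) holomorphic_on {\<tau>. Im \<tau> > 0}"
    using *(1) by (intro holomorphic_on_compose_gen[OF _ F] mob_holomorphic) (auto intro!: Im_mob_pos)
  thus ?thesis
    by (rule holomorphic_transform) (simp add: *(2))
qed

lemma SL2_orbit_mob:
  assumes f: "f \<in> SL2_orbit F" and det: "a * d - b * c = 1"
  shows "(\<lambda>\<tau>. if Im \<tau> > 0 then f (mob a b c d \<tau>) else 0) \<in> SL2_orbit F"
proof -
  obtain a' b' c' d' where *: "a' * d' - b' * c' = 1" "f = (\<lambda>\<tau>. if Im \<tau> > 0 then F (mob a' b' c' d' \<tau>) else 0)"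
    using f by (rule SL2_orbitE)
  have "(\<lambda>\<tau>. if Im \<tau> > 0 then f (mob a b c d \<tau>) else 0) =
      (\<lambda>\<tau>. if Im \<tau> > 0 then F (mob (a' * a + b' * c) (a' * b + b' * d) (c' * a + d' * c) (c' * b + d' * d) \<tau>) else 0)"
    using det by (auto simp: fun_eq_iff *(2) mob_mob Im_mob_pos)
  moreover have "(a' * a + b' * c) * (c' * b + d' * d) - (a' * b + b' * d) * (c' * a + d' * c) =
      (a' * d' - b' * c') * (a * d - b * c)"
    by (simp add: algebra_simps)
  ultimately show ?thesis
    unfolding SL2_orbit_def using det *(1) by (auto intro!: exI)
qed

lemma mob_inverse:
  assumes "a * d - b * c = 1" and "Im \<tau> > 0"
  shows "mob a b c d (mob d (-b) (-c) a \<tau>) = \<tau>"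
  using mob_mob[of d a "-b" "-c" \<tau> a b c d] assms by (simp add: mob_def algebra_simps flip: of_int_mult of_int_diff)

text \<open>Precomposition with the matrix is an injective map of the finite orbit to itself, hence
  it merely permutes the factors.\<close>

lemma prod_SL2_orbit_invariant:
  assumes fin: "finite (SL2_orbit F)" and det: "a * d - b * c = 1" and tau: "Im \<tau> > 0"
  shows "(\<Prod>f\<in>SL2_orbit F. f (mob a b c d \<tau>)) = (\<Prod>f\<in>SL2_orbit F. f \<tau>)"
proof -
  define T where "T = (\<lambda>f \<tau>. if Im \<tau> > 0 then f (mob a b c d \<tau>) else (0::complex))"
  have "inj_on T (SL2_orbit F)"
  proof
    fix f g assume fg: "f \<in> SL2_orbit F" "g \<in> SL2_orbit F" "T f = T g"
    show "f = g"
    proof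
      fix \<tau>
      show "f \<tau> = g \<tau>"
      proof (cases "Im \<tau> > 0")
        case True
        hence "Im (mob d (-b) (-c) a \<tau>) > 0"
          using det by (intro Im_mob_pos) (auto simp: mult.commute)
        thus ?thesis
          using fun_cong[OF fg(3), of "mob d (-b) (-c) a \<tau>"] mob_inverse[OF det True]
          by (simp add: T_def)
      next
        case False
        thus ?thesis
          using fg(1,2) by (auto elim!: SL2_orbitE)
      qed
    qed
  qed
  moreover have "T ` SL2_orbit F \<subseteq> SL2_orbit F"
    unfolding T_def using SL2_orbit_mob[OF _ det] by blast
  ultimately have "bij_betw T (SL2_orbit F) (SL2_orbit F)"
    using endo_inj_surj[OF fin] by (auto simp: bij_betw_def)
  hence "(\<Prod>f\<in>SL2_orbit F. T f \<tau>) = (\<Prod>f\<in>SL2_orbit F. f \<tau>)"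
    by (rule prod.reindex_bij_betw)
  thus ?thesis
    using tau by (simp add: T_def)
qed

text \<open>Inversion at least doubles the imaginary part as long as it is below \<open>1/2\<close> and the real
  part is at most \<open>1/2\<close> in absolute value.\<close>

lemma invariant_reduce:
  assumes T: "\<And>\<tau> k. Im \<tau> > 0 \<Longrightarrow> G (\<tau> + of_int k) = G \<tau>"
    and S: "\<And>\<tau>. Im \<tau> > 0 \<Longrightarrow> G (-1 / \<tau>) = G \<tau>"
    and tau: "Im \<tau> > 0"
  obtains \<sigma> where "Im \<sigma> \<ge> 1/2" "\<bar>Re \<sigma>\<bar> \<le> 1/2" "G \<sigma> = G \<tau>"
proof -
  \<comment> \<open>The number \<open>n\<close> bounds the doublings still to be made: each
    inversion improves the lower bound \<open>1 / 2 ^ n\<close> by a factor 2.\<close>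
  have "\<exists>\<sigma>. Im \<sigma> \<ge> 1/2 \<and> \<bar>Re \<sigma>\<bar> \<le> 1/2 \<and> G \<sigma> = G \<tau>"
    if "Im \<tau> \<ge> 1 / 2 ^ n" "Im \<tau> > 0" for n \<tau>
    using that
  proof (induction n arbitrary: \<tau>)
    case (0 \<tau>)
    define \<sigma> where "\<sigma> = \<tau> + of_int (- round (Re \<tau>))"
    have "\<bar>Re \<sigma>\<bar> \<le> 1/2"
      using of_int_round_abs_le[of "Re \<tau>"] by (simp add: \<sigma>_def abs_minus_commute)
    moreover have "Im \<sigma> = Im \<tau>" "G \<sigma> = G \<tau>"
      using T[of \<tau> "- round (Re \<tau>)"] 0 by (simp_all add: \<sigma>_def)
    ultimately show ?case using 0 by (intro exI[of _ \<sigma>]) auto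
  next
    case (Suc n \<tau>)
    define \<rho> where "\<rho> = \<tau> + of_int (- round (Re \<tau>))"
    have re: "\<bar>Re \<rho>\<bar> \<le> 1/2"
      using of_int_round_abs_le[of "Re \<tau>"] by (simp add: \<rho>_def abs_minus_commute)
    have im: "Im \<rho> = Im \<tau>" and G: "G \<rho> = G \<tau>"
      using T[of \<tau> "- round (Re \<tau>)"] Suc.prems by (simp_all add: \<rho>_def)
    show ?case
    proof (cases "Im \<rho> \<ge> 1/2")
      case True
      with re G show ?thesis by auto
    next
      case False
      have "(Re \<rho>)\<^sup>2 + (Im \<rho>)\<^sup>2 \<le> (1/2)\<^sup>2 + (1/2)\<^sup>2"
        using re False im Suc.prems by (intro add_mono abs_le_square_iff[THEN iffD1]) auto
      moreover have "(Re \<rho>)\<^sup>2 + (Im \<rho>)\<^sup>2 > 0"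
        using im Suc.prems by (intro add_nonneg_pos) auto
      ultimately have "Im \<rho> / ((Re \<rho>)\<^sup>2 + (Im \<rho>)\<^sup>2) \<ge> Im \<rho> / (1/2)"
        using im Suc.prems by (intro divide_left_mono) (auto simp: power2_eq_square)
      hence "Im (-1 / \<rho>) \<ge> 2 * Im \<tau>"
        using im by (simp add: Im_divide)
      moreover have "2 * Im \<tau> \<ge> 1 / 2 ^ n"
        using Suc.prems by simp
      ultimately have "\<exists>\<sigma>. Im \<sigma> \<ge> 1/2 \<and> \<bar>Re \<sigma>\<bar> \<le> 1/2 \<and> G \<sigma> = G (-1 / \<rho>)"
        using Suc.prems by (intro Suc.IH) auto
      thus ?thesis
        using S[of \<rho>] im G Suc.prems by simp
    qed
  qed
  moreover obtain n where "Im \<tau> \<ge> 1 / 2 ^ n"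
    using real_arch_pow_inv[OF tau, of "1/2"] by (auto simp: power_divide intro: less_imp_le)
  ultimately show ?thesis
    using tau that by blast
qed

text \<open>Holomorphic functions on a connected open set form an integral domain: on the open set
  where one factor is nonzero the other factors multiply to 0, and the identity theorem extends this
  to \<open>S\<close>.\<close>

lemma prod_holomorphic_eq_0:
  assumes "finite I" and S: "open S" "connected S" "S \<noteq> {}"
    and hol: "\<And>f. f \<in> I \<Longrightarrow> f holomorphic_on S"
    and zero: "\<And>z. z \<in> S \<Longrightarrow> (\<Prod>f\<in>I. f z) = 0"
  shows "\<exists>f\<in>I. \<forall>z\<in>S. f z = 0"
  using assms(1) hol zero
proof (induction I)
  case empty
  thus ?case using S by auto
next
  case (insert f I)
  show ?case
  proof (cases "\<forall>z\<in>S. f z = 0")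
    case False
    then obtain z0 where z0: "z0 \<in> S" "f z0 \<noteq> 0" by blast
    define U where "U = {z \<in> S. f z \<noteq> 0}"
    have "continuous_on S f"
      using insert.prems by (intro holomorphic_on_imp_continuous_on) auto
    hence U: "open U"
      using continuous_open_preimage[of S f "- {0}"] S(1) by (simp add: U_def vimage_def Int_def open_Compl)
    have "(\<Prod>g\<in>I. g w) = 0" if "w \<in> S" for w
    proof (rule analytic_continuation[of "\<lambda>z. \<Prod>g\<in>I. g z" S U z0])
      show "(\<lambda>z. \<Prod>g\<in>I. g z) holomorphic_on S"
        using insert.prems by (intro holomorphic_on_prod) auto
      show "z0 islimpt U"
        using U z0 by (intro open_imp_islimpt) (auto simp: U_def)
      show "(\<Prod>g\<in>I. g z) = 0" if "z \<in> U" for z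
        using that insert.prems(2)[of z] insert.hyps by (auto simp: U_def)
    qed (use S z0 that in \<open>auto simp: U_def\<close>)
    thus ?thesis
      using insert.IH insert.prems by blast
  qed auto
qed

text \<open>In the product \<open>G\<close> over the orbit one factor, \<open>F\<close> itself,
  tends to 0 at infinity while the others stay bounded, so \<open>G\<close> tends to 0. A nonzero
  value would force \<open>norm G\<close> to attain a maximum, making \<open>G\<close> constant and
  hence not small at infinity.\<close>

theorem SL2_finite_orbit_eq_0:
  assumes hol: "F holomorphic_on {\<tau>. Im \<tau> > 0}"
    and fin: "finite (SL2_orbit F)"
    and bdd: "\<And>a b c d. a * d - b * c = 1 \<Longrightarrow> \<exists>B. eventually (\<lambda>\<tau>. norm (F (mob a b c d \<tau>)) \<le> B) at_cusp"
    and lim: "(F \<longlongrightarrow> 0) at_cusp"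
    and tau: "Im \<tau> > 0"
  shows "F \<tau> = 0"
proof -
  define H where "H = {\<tau>. Im \<tau> > 0}"
  define G where "G = (\<lambda>\<tau>. \<Prod>f\<in>SL2_orbit F. f \<tau>)"
  define F' where "F' = (\<lambda>\<tau>. if Im \<tau> > 0 then F \<tau> else 0)"
  have ev_pos: "eventually (\<lambda>\<tau>. Im \<tau> > 0) at_cusp"
    unfolding eventually_at_cusp by (rule exI[of _ 0]) simp
  have F': "F' \<in> SL2_orbit F"
    unfolding SL2_orbit_def F'_def
    by (rule CollectI, rule exI[of _ 1], rule exI[of _ 0], rule exI[of _ 0], rule exI[of _ 1])
       (simp add: mob_def fun_eq_iff)
  have "\<exists>B. eventually (\<lambda>\<tau>. norm (f \<tau>) \<le> B) at_cusp" if "f \<in> SL2_orbit F" for f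
  proof -
    obtain a b c d where *: "a * d - b * c = 1" "f = (\<lambda>\<tau>. if Im \<tau> > 0 then F (mob a b c d \<tau>) else 0)"
      using \<open>f \<in> SL2_orbit F\<close> by (rule SL2_orbitE)
    obtain B where "eventually (\<lambda>\<tau>. norm (F (mob a b c d \<tau>)) \<le> B) at_cusp"
      using bdd[OF *(1)] by blast
    with ev_pos have "eventually (\<lambda>\<tau>. norm (f \<tau>) \<le> B) at_cusp"
      by eventually_elim (simp add: *(2))
    thus ?thesis ..
  qed
  then obtain B where B: "\<And>f. f \<in> SL2_orbit F \<Longrightarrow> eventually (\<lambda>\<tau>. norm (f \<tau>) \<le> B f) at_cusp"
    by metis
  hence "eventually (\<lambda>\<tau>. \<forall>f\<in>SL2_orbit F. norm (f \<tau>) \<le> B f) at_cusp"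
    by (intro eventually_ball_finite fin) auto
  hence "eventually (\<lambda>\<tau>. norm (G \<tau>) \<le> norm (F' \<tau>) * (\<Prod>f\<in>SL2_orbit F - {F'}. B f)) at_cusp"
  proof eventually_elim
    case (elim \<tau>)
    have "norm (G \<tau>) = norm (F' \<tau>) * (\<Prod>f\<in>SL2_orbit F - {F'}. norm (f \<tau>))"
      unfolding G_def using prod.remove[OF fin F', of "\<lambda>f. f \<tau>"] by (simp add: norm_mult prod_norm)
    also have "\<dots> \<le> norm (F' \<tau>) * (\<Prod>f\<in>SL2_orbit F - {F'}. B f)"
      using elim by (intro mult_left_mono prod_mono) auto
    finally show ?case .
  qed
  moreover have "((\<lambda>\<tau>. norm (F' \<tau>) * (\<Prod>f\<in>SL2_orbit F - {F'}. B f)) \<longlongrightarrow> 0) at_cusp"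
  proof -
    have "(F' \<longlongrightarrow> 0) at_cusp"
      using lim by (rule Lim_transform_eventually) (use ev_pos in \<open>auto simp: F'_def elim: eventually_mono\<close>)
    thus ?thesis
      by (intro tendsto_mult_left_zero tendsto_norm_zero)
  qed
  ultimately have G_lim: "(G \<longlongrightarrow> 0) at_cusp"
    by (rule Lim_null_comparison)
  have G_inv: "G (mob a b c d z) = G z" if "a * d - b * c = 1" "Im z > 0" for a b c d z
    unfolding G_def using fin that by (rule prod_SL2_orbit_invariant)
  have G_T: "G (z + of_int k) = G z" if "Im z > 0" for z k
    using G_inv[of 1 1 k 0 z] that by (simp add: mob_def)
  have G_S: "G (-1 / z) = G z" if "Im z > 0" for z
    using G_inv[of 0 0 "-1" 1 z] that by (simp add: mob_def)
  have G_hol: "G holomorphic_on H"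
    unfolding G_def H_def using SL2_orbit_holomorphic[OF _ hol] by (intro holomorphic_on_prod)
  have H: "open H" "connected H" "\<tau> \<in> H"
    using open_upper_half_plane connected_upper_half_plane tau by (simp_all add: H_def)
  have G_0: "G z = 0" if "z \<in> H" for z
  proof (rule ccontr)
    assume "G z \<noteq> 0"
    hence "eventually (\<lambda>w. norm (G w) < norm (G z)) at_cusp"
      using tendstoD[OF G_lim, of "norm (G z)"] by simp
    then obtain Y where Y: "\<And>w. Im w > Y \<Longrightarrow> norm (G w) < norm (G z)"
      unfolding eventually_at_cusp by blast
    \<comment> \<open>This compact box contains every reduced point at which \<open>norm G\<close>
      is at least \<open>norm (G z)\<close>, as above height \<open>Y\<close> it is smaller.\<close>
    define K where "K = cbox (Complex (-1/2) (1/2)) (Complex (1/2) Y)"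
    have K: "w \<in> K" if "Im w \<ge> 1/2" "\<bar>Re w\<bar> \<le> 1/2" "norm (G w) \<ge> norm (G z)" for w
      using that Y[of w] by (auto simp: K_def in_cbox_complex_iff abs_le_iff not_less[symmetric])
    obtain z' where z': "Im z' \<ge> 1/2" "\<bar>Re z'\<bar> \<le> 1/2" "G z' = G z"
      using invariant_reduce[of G z] G_T G_S \<open>z \<in> H\<close> unfolding H_def by blast
    have "K \<subseteq> H"
      by (auto simp: K_def H_def in_cbox_complex_iff)
    hence "continuous_on K (\<lambda>w. norm (G w))"
      using G_hol by (intro continuous_intros holomorphic_on_imp_continuous_on) (rule holomorphic_on_subset)
    moreover have "z' \<in> K"
      using z' by (intro K) auto
    moreover have "compact K"
      by (simp add: K_def)
    ultimately obtain \<xi> where \<xi>: "\<xi> \<in> K" "\<And>w. w \<in> K \<Longrightarrow> norm (G w) \<le> norm (G \<xi>)"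
      using continuous_attains_sup[of K "\<lambda>w. norm (G w)"] by auto
    have "norm (G w) \<le> norm (G \<xi>)" if w: "w \<in> H" for w
    proof -
      obtain w' where w': "Im w' \<ge> 1/2" "\<bar>Re w'\<bar> \<le> 1/2" "G w' = G w"
        using invariant_reduce[of G w] G_T G_S w unfolding H_def by blast
      show ?thesis
      proof (cases "norm (G w) \<ge> norm (G z)")
        case True
        thus ?thesis using \<xi>(2)[of w'] K[of w'] w' by simp
      next
        case False
        thus ?thesis using \<xi>(2)[OF \<open>z' \<in> K\<close>] z' by simp
      qed
    qed
    hence "G constant_on H"
      using \<xi>(1) \<open>K \<subseteq> H\<close> by (intro maximum_modulus_principle[OF G_hol H(1,2) H(1) order_refl, of \<xi>]) auto
    hence "G (Complex 0 (max 1 (Y + 1))) = G z"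
      using \<open>z \<in> H\<close> unfolding constant_on_def H_def
      by (metis (mono_tags, lifting) complex.sel(2) less_max_iff_disj mem_Collect_eq zero_less_one)
    thus False
      using Y[of "Complex 0 (max 1 (Y + 1))"] by (simp add: less_max_iff_disj)
  qed
  \<comment> \<open>Some translate of \<open>F\<close> vanishes identically; undoing its matrix
    gives the claim for \<open>F\<close>.\<close>
  have "\<exists>f\<in>SL2_orbit F. \<forall>z\<in>H. f z = 0"
    using G_0 H by (intro prod_holomorphic_eq_0 fin) (auto simp: G_def H_def intro: SL2_orbit_holomorphic[OF _ hol])
  then obtain f where f: "f \<in> SL2_orbit F" "\<And>z. z \<in> H \<Longrightarrow> f z = 0"
    by blast
  obtain a b c d where *: "a * d - b * c = 1" "f = (\<lambda>\<tau>. if Im \<tau> > 0 then F (mob a b c d \<tau>) else 0)"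
    using f(1) by (rule SL2_orbitE)
  have "Im (mob d (-b) (-c) a \<tau>) > 0"
    using *(1) tau by (intro Im_mob_pos) (auto simp: mult.commute)
  thus ?thesis
    using f(2)[of "mob d (-b) (-c) a \<tau>"] mob_inverse[OF *(1) tau] by (simp add: *(2) H_def)
qed

section \<open>The relation as a function on the upper half plane\<close>

text \<open>For \<open>p = P\<^sup>2\<close> and \<open>c = Q\<close>, the bound \<open>v\<close> and \<open>w\<close> are \<open>u\<^sup>2\<close> and \<open>B u\<close>.\<close>

definition modular_relation :: "complex \<Rightarrow> complex \<Rightarrow> complex" where
  "modular_relation p c = (let v = p / c\<^sup>2 + 2 + c\<^sup>2 / p; w = p + c\<^sup>2 + 169 / p + 169 / c\<^sup>2 in
     (p * c\<^sup>2 + 338 + 28561 / (p * c\<^sup>2)) - w * (v ^ 4 - v ^ 3 - 21 * v ^ 2 + 35 * v + 30)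
     + v ^ 6 + 4 * v ^ 5 - 26 * v ^ 4 + 89 * v ^ 3 - 829 * v ^ 2 + 1821 * v - 576)"

definition relation_fun :: "complex \<Rightarrow> complex" where
  "relation_fun \<tau> = modular_relation (- etaA \<tau>) (etaC \<tau>)"

lemma etaA_nonzero: "Im \<tau> > 0 \<Longrightarrow> etaA \<tau> \<noteq> 0"
  by (simp add: etaA_def eta2_nonzero)

lemma etaC_nonzero: "Im \<tau> > 0 \<Longrightarrow> etaC \<tau> \<noteq> 0"
  by (simp add: etaC_def eta2_nonzero)

lemma relation_fun_holomorphic: "relation_fun holomorphic_on {\<tau>. Im \<tau> > 0}"
proof -
  have "etaA holomorphic_on {\<tau>. Im \<tau> > 0}" "etaC holomorphic_on {\<tau>. Im \<tau> > 0}"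
    unfolding etaA_def etaC_def using open_upper_half_plane
    by (intro holomorphic_intros eta2_holomorphic; simp add: eta2_nonzero)+
  thus ?thesis
    unfolding relation_fun_def modular_relation_def Let_def
    by (intro holomorphic_intros) (auto simp: etaA_nonzero etaC_nonzero)
qed

lemma relation_fun_Gamma0_26:
  assumes "a * d - b * c = 1" and "26 dvd c" and "Im \<tau> > 0"
  shows "relation_fun (mob a b c d \<tau>) = relation_fun \<tau>"
  using assms etaA_etaC_invariant[of a d b "c div 26" \<tau>] by (simp add: relation_fun_def)

text \<open>The substitution swaps \<open>p / c ^ 2\<close> with \<open>c ^ 2 / p\<close>,
  \<open>p\<close> with \<open>169 / p\<close> and \<open>c ^ 2\<close> with
  \<open>169 / c ^ 2\<close>, and the relation is symmetric under these swaps.\<close>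

lemma modular_relation_atkin_lehner:
  assumes "p \<noteq> 0" and "c \<noteq> 0"
  shows "modular_relation (169 / p) (13 / c) = modular_relation p c"
proof -
  have 1: "(169 / p) / (13 / c)\<^sup>2 = c\<^sup>2 / p" and 2: "(13 / c)\<^sup>2 / (169 / p) = p / c\<^sup>2"
    and 3: "169 / (169 / p) = p" and 4: "169 / (13 / c)\<^sup>2 = c\<^sup>2" and 5: "(13 / c)\<^sup>2 = 169 / c\<^sup>2"
    and 6: "169 / p * (169 / c\<^sup>2) = 28561 / (p * c\<^sup>2)" and 7: "28561 / (28561 / (p * c\<^sup>2)) = p * c\<^sup>2"
    using assms by (simp_all add: power_divide)
  have 8: "c\<^sup>2 / p + 2 + p / c\<^sup>2 = p / c\<^sup>2 + 2 + c\<^sup>2 / p"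
    and 9: "169 / p + 169 / c\<^sup>2 + p + c\<^sup>2 = p + c\<^sup>2 + 169 / p + 169 / c\<^sup>2"
    and 10: "28561 / (p * c\<^sup>2) + 338 + p * c\<^sup>2 = p * c\<^sup>2 + 338 + 28561 / (p * c\<^sup>2)"
    by simp_all
  show ?thesis
    unfolding modular_relation_def Let_def 1 2 3 4 unfolding 5 6 7 8 9 10 ..
qed

lemma relation_fun_atkin_lehner:
  assumes "Im \<tau> > 0"
  shows "relation_fun (mob 13 6 26 13 \<tau>) = relation_fun \<tau>"
  using modular_relation_atkin_lehner[of "- etaA \<tau>" "etaC \<tau>"] etaA_nonzero[OF assms] etaC_nonzero[OF assms]
  by (simp add: relation_fun_def etaA_etaC_atkin_lehner[OF assms])

text \<open>The number assumed divisible by 26 is the lower left entry of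
  \<open>(a, b; c, d) T^(-k) (p, q; r, s)^(-1)\<close>, with \<open>T\<close> the translation by 1;
  so this matrix lies in Gamma_0(26).\<close>

lemma relation_fun_coset:
  assumes "a * d - b * c = 1" and "p * s - q * r = 1" and dvd: "26 dvd c * s - (d - k * c) * r"
    and tau: "Im \<tau> > 0"
  shows "relation_fun (mob a b c d \<tau>) = relation_fun (mob p q r s (\<tau> + of_int k))"
proof -
  define b' where "b' = b - k * a"
  define d' where "d' = d - k * c"
  have tau': "Im (\<tau> + of_int k) > 0"
    using tau by simp
  have "(a * s - b' * r) * (d' * p - c * q) - (b' * p - a * q) * (c * s - d' * r) =
      (a * d' - b' * c) * (p * s - q * r)"
    by (simp add: algebra_simps)
  moreover have det': "a * d' - b' * c = 1"
    using assms(1) by (simp add: b'_def d'_def algebra_simps)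
  ultimately have det: "(a * s - b' * r) * (d' * p - c * q) - (b' * p - a * q) * (c * s - d' * r) = 1"
    using assms(2) by simp
  have "mob (a * s - b' * r) (b' * p - a * q) (c * s - d' * r) (d' * p - c * q) (mob p q r s (\<tau> + of_int k)) =
      mob (a * (p * s - q * r)) (b' * (p * s - q * r)) (c * (p * s - q * r)) (d' * (p * s - q * r)) (\<tau> + of_int k)"
    using assms(2) tau' by (subst mob_mob) (simp_all add: algebra_simps)
  also have "\<dots> = mob a b c d \<tau>"
    using assms(2) by (simp add: mob_def b'_def d'_def algebra_simps)
  finally have "relation_fun (mob a b c d \<tau>) =
      relation_fun (mob (a * s - b' * r) (b' * p - a * q) (c * s - d' * r) (d' * p - c * q) (mob p q r s (\<tau> + of_int k)))"
    by simp
  also have "\<dots> = relation_fun (mob p q r s (\<tau> + of_int k))"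
    using det dvd assms(2) tau' by (intro relation_fun_Gamma0_26 Im_mob_pos) (auto simp: d'_def)
  finally show ?thesis .
qed

section \<open>Cusps of Gamma_0(26) and finiteness of the orbit\<close>

lemma fermat_13:
  assumes "\<not> 13 dvd c"
  shows "13 dvd c ^ 12 - (1::int)"
proof -
  have "\<forall>c\<in>set [1..12]. c ^ 12 mod 13 = (1::int)"
    by code_simp
  moreover have "c mod 13 \<in> set [1..12]"
    using assms pos_mod_bound[of 13 c] pos_mod_sign[of 13 c] by (auto simp: dvd_eq_mod_eq_0)
  ultimately have "(c mod 13) ^ 12 mod 13 = 1"
    by blast
  hence "c ^ 12 mod 13 = 1 mod 13"
    by (simp add: power_mod)
  thus ?thesis
    by (simp only: mod_eq_dvd_iff)
qed

text \<open>Matrices mapping infinity to representatives of the four cusps of \<open>\<Gamma>\<^sub>0(26)\<close>. The last two are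
  chosen so that the Atkin-Lehner involution relates them to the first two.\<close>

definition cusps26 :: "(int \<times> int \<times> int \<times> int) set" where
  "cusps26 = {(1, 0, 0, 1), (0, -1, 1, 0), (1, 0, 2, 1), (6, -1, 13, -2)}"

text \<open>Which of 2 and 13 divide \<open>c\<close> decides the representative. The translation
  \<open>k\<close> then solves a linear congruence, with \<open>c ^ 11\<close> as the inverse of
  \<open>c\<close> modulo 13, and it may be reduced modulo 26.\<close>

lemma cusps26_coset:
  assumes det: "a * d - b * c = 1"
  obtains p q r s k where "(p, q, r, s) \<in> cusps26" "k \<in> {0..<26}" "26 dvd c * s - (d - k * c) * r"
proof -
  have "\<exists>(p, q, r, s)\<in>cusps26. \<exists>k. 26 dvd c * s - (d - k * c) * r"
  proof -
    have dvd26: "26 dvd x" if "2 dvd x" "13 dvd x" for x :: int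
      using that by presburger
    show ?thesis
    proof (cases "2 dvd c"; cases "13 dvd c")
      assume "2 dvd c" "13 dvd c"
      thus ?thesis using dvd26 by (auto simp: cusps26_def)
    next
      assume c: "\<not> 2 dvd c" "13 dvd c"
      have "26 dvd c * -2 - (d - d * c) * 13"
        using c by (intro dvd26) auto
      thus ?thesis by (auto simp: cusps26_def)
    next
      assume c: "2 dvd c" "\<not> 13 dvd c"
      \<comment> \<open>In \<open>k = c ^ 11 * d - 7\<close> the first term removes \<open>d\<close>
        modulo 13 and the 7 turns \<open>c\<close> into \<open>-13 * c\<close>.\<close>
      have "c * 1 - (d - (c ^ 11 * d - 7) * c) * 2 = 2 * d * (c ^ 12 - 1) - 13 * c"
        by (simp add: algebra_simps power_numeral_reduce)
      moreover have "26 dvd 2 * d * (c ^ 12 - 1) - 13 * c"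
        using c fermat_13[OF c(2)] by (intro dvd26) auto
      ultimately have "26 dvd c * 1 - (d - (c ^ 11 * d - 7) * c) * 2"
        by (simp only:)
      thus ?thesis
        by (intro bexI[of _ "(1, 0, 2, 1)"]) (unfold prod.case, rule exI, assumption, simp add: cusps26_def)
    next
      assume c: "\<not> 2 dvd c" "\<not> 13 dvd c"
      have "c * 0 - (d - c ^ 11 * d * c) * 1 = d * (c ^ 12 - 1)"
        by (simp add: algebra_simps power_numeral_reduce)
      moreover have "26 dvd d * (c ^ 12 - 1)"
        using c fermat_13[OF c(2)] by (intro dvd26) auto
      ultimately have "26 dvd c * 0 - (d - c ^ 11 * d * c) * 1"
        by (simp only:)
      thus ?thesis
        by (intro bexI[of _ "(0, -1, 1, 0)"]) (unfold prod.case, rule exI, assumption, simp add: cusps26_def)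
    qed
  qed
  then obtain x where "x \<in> cusps26" "case x of (p, q, r, s) \<Rightarrow> \<exists>k. 26 dvd c * s - (d - k * c) * r" ..
  then obtain p q r s k where *: "(p, q, r, s) \<in> cusps26" "26 dvd c * s - (d - k * c) * r"
    by (cases x) auto
  have "c * s - (d - k * c) * r = (c * s - (d - (k mod 26) * c) * r) + 26 * ((k div 26) * c * r)"
  proof -
    have "26 * (k div 26) + k mod 26 = k" by simp
    hence "c * s - (d - k * c) * r = c * s - (d - (26 * (k div 26) + k mod 26) * c) * r" by (simp only:)
    thus ?thesis by (simp only: algebra_simps)
  qed
  with *(2) have "26 dvd c * s - (d - (k mod 26) * c) * r"
    by (metis dvd_add_times_triv_right_iff mult.commute)
  thus ?thesis
    using *(1) by (intro that[of p q r s "k mod 26"]) auto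
qed

lemma det_cusps26: "(p, q, r, s) \<in> cusps26 \<Longrightarrow> p * s - q * r = 1"
  by (auto simp: cusps26_def)

lemma finite_orbit_relation_fun: "finite (SL2_orbit relation_fun)"
proof (rule finite_subset)
  show "SL2_orbit relation_fun \<subseteq> (\<lambda>((p, q, r, s), k) \<tau>. if Im \<tau> > 0 then relation_fun (mob p q r s (\<tau> + of_int k)) else 0) `
      (cusps26 \<times> {0..<26})"
  proof
    fix f assume "f \<in> SL2_orbit relation_fun"
    then obtain a b c d where f: "a * d - b * c = 1" "f = (\<lambda>\<tau>. if Im \<tau> > 0 then relation_fun (mob a b c d \<tau>) else 0)"
      by (rule SL2_orbitE)
    obtain p q r s k where *: "(p, q, r, s) \<in> cusps26" "k \<in> {0..<26}" "26 dvd c * s - (d - k * c) * r"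
      using f(1) by (rule cusps26_coset)
    have "f = (\<lambda>\<tau>. if Im \<tau> > 0 then relation_fun (mob p q r s (\<tau> + of_int k)) else 0)"
      using relation_fun_coset[OF f(1) det_cusps26[OF *(1)] *(3)] by (simp add: f(2) fun_eq_iff)
    thus "f \<in> (\<lambda>((p, q, r, s), k) \<tau>. if Im \<tau> > 0 then relation_fun (mob p q r s (\<tau> + of_int k)) else 0) `
        (cusps26 \<times> {0..<26})"
      using *(1,2) by (intro image_eqI[of _ _ "((p, q, r, s), k)"]) auto
  qed
  show "finite ((\<lambda>((p, q, r, s), k) \<tau>. if Im \<tau> > 0 then relation_fun (mob p q r s (\<tau> + of_int k)) else 0) `
      (cusps26 \<times> {0..<26}))"
    by (simp add: cusps26_def)
qed

lemma filterlim_at_cusp_affine: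
  assumes "m > 0"
  shows "filterlim (\<lambda>\<tau>. of_real m * \<tau> + of_real x) at_cusp at_cusp"
  unfolding filterlim_iff eventually_at_cusp
proof safe
  fix P :: "complex \<Rightarrow> bool" and Y assume "\<forall>\<tau>. Im \<tau> > Y \<longrightarrow> P \<tau>"
  thus "\<exists>Y. \<forall>\<tau>. Im \<tau> > Y \<longrightarrow> P (of_real m * \<tau> + of_real x)"
    using assms by (intro exI[of _ "Y / m"]) (auto simp: field_simps)
qed

text \<open>The hypotheses treat the cusps infinity and 0; the Atkin-Lehner involution transports
  the bounds to the other two representatives, and \<open>relation_fun_coset\<close> to all
  matrices.\<close>

lemma relation_fun_bounded_at_cusps:
  assumes "(relation_fun \<longlongrightarrow> 0) at_cusp" and S: "eventually (\<lambda>\<tau>. norm (relation_fun (-1 / \<tau>)) \<le> B) at_cusp"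
    and det: "a * d - b * c = 1"
  shows "\<exists>B. eventually (\<lambda>\<tau>. norm (relation_fun (mob a b c d \<tau>)) \<le> B) at_cusp"
proof -
  have ev_pos: "eventually (\<lambda>\<tau>. Im \<tau> > 0) at_cusp"
    unfolding eventually_at_cusp by (rule exI[of _ 0]) simp
  have I: "eventually (\<lambda>\<tau>. norm (relation_fun \<tau>) \<le> 1) at_cusp"
    using tendstoD[OF assms(1), of 1] by (auto elim: eventually_mono)
  have "\<exists>B. eventually (\<lambda>\<tau>. norm (relation_fun (mob p q r s \<tau>)) \<le> B) at_cusp"
    if "(p, q, r, s) \<in> cusps26" for p q r s
  proof -
    have "eventually (\<lambda>\<tau>. norm (relation_fun (mob 1 0 2 1 \<tau>)) \<le> 1) at_cusp"
      using ev_pos eventually_compose_filterlim[OF I filterlim_at_cusp_affine[of "1/13" "-6/13"], simplified]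
    proof eventually_elim
      case (elim \<tau>)
      have "13 * (\<tau> / 13 - 6 / 13) + 6 = \<tau>" "26 * (\<tau> / 13 - 6 / 13) + 13 = 2 * \<tau> + 1"
        by (simp_all add: algebra_simps)
      hence "mob 1 0 2 1 \<tau> = mob 13 6 26 13 (\<tau> / 13 - 6 / 13)"
        by (simp add: mob_def)
      thus ?case
        using elim relation_fun_atkin_lehner[of "\<tau> / 13 - 6 / 13"] by simp
    qed
    moreover have "eventually (\<lambda>\<tau>. norm (relation_fun (mob 6 (-1) 13 (-2) \<tau>)) \<le> B) at_cusp"
      using ev_pos eventually_compose_filterlim[OF S filterlim_at_cusp_affine[of 13 0], simplified]
    proof eventually_elim
      case (elim \<tau>)
      have "\<tau> \<noteq> 0" using elim(1) by auto
      hence "13 * (-1 / (13 * \<tau>)) + 6 = (6 * \<tau> - 1) / \<tau>" "26 * (-1 / (13 * \<tau>)) + 13 = (13 * \<tau> - 2) / \<tau>"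
        by (simp_all add: field_simps)
      hence "mob 13 6 26 13 (-1 / (13 * \<tau>)) = mob 6 (-1) 13 (-2) \<tau>"
        using \<open>\<tau> \<noteq> 0\<close> by (simp add: mob_def)
      thus ?case
        using elim relation_fun_atkin_lehner[of "-1 / (13 * \<tau>)"] Im_minus_inverse_pos[of "13 * \<tau>"] by simp
    qed
    ultimately show ?thesis
      using that I S by (auto simp: cusps26_def mob_def)
  qed
  moreover obtain p q r s k where *: "(p, q, r, s) \<in> cusps26" "k \<in> {0..<26}" "26 dvd c * s - (d - k * c) * r"
    using det by (rule cusps26_coset)
  ultimately obtain B where "eventually (\<lambda>\<tau>. norm (relation_fun (mob p q r s \<tau>)) \<le> B) at_cusp"
    by blast
  from ev_pos eventually_compose_filterlim[OF this filterlim_at_cusp_affine[of 1 "of_int k"], simplified]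
  have "eventually (\<lambda>\<tau>. norm (relation_fun (mob a b c d \<tau>)) \<le> B) at_cusp"
    by eventually_elim (simp add: relation_fun_coset[OF det det_cusps26[OF *(1)] *(3)])
  thus ?thesis ..
qed

section \<open>Truncated power series\<close>

text \<open>Integer coefficient lists stand for polynomials, and \<open>trunc_eq n f xs\<close> states that \<open>f\<close> agrees
  with one up to \<open>O(q\<^sup>n)\<close>, so that expansions are computed by rewriting.\<close>

fun ladd :: "int list \<Rightarrow> int list \<Rightarrow> int list" where
  "ladd [] ys = ys"
| "ladd xs [] = xs"
| "ladd (x # xs) (y # ys) = (x + y) # ladd xs ys"

fun lmul :: "int list \<Rightarrow> int list \<Rightarrow> int list" where
  "lmul [] ys = []"
| "lmul (x # xs) ys = ladd (map ((*) x) ys) (0 # lmul xs ys)"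

fun leval :: "int list \<Rightarrow> complex \<Rightarrow> complex" where
  "leval [] q = 0"
| "leval (x # xs) q = of_int x + q * leval xs q"

lemma leval_ladd: "leval (ladd xs ys) q = leval xs q + leval ys q"
  by (induction xs ys rule: ladd.induct) (simp_all add: algebra_simps)

lemma leval_smult: "leval (map ((*) c) xs) q = of_int c * leval xs q"
  by (induction xs) (simp_all add: algebra_simps)

lemma leval_lmul: "leval (lmul xs ys) q = leval xs q * leval ys q"
  by (induction xs) (simp_all add: leval_ladd leval_smult algebra_simps)

lemma leval_append: "leval (xs @ ys) q = leval xs q + q ^ length xs * leval ys q"
  by (induction xs) (simp_all add: algebra_simps)

lemma leval_replicate_0 [simp]: "leval (replicate n 0) q = 0"
  by (induction n) simp_all

lemma leval_O_1: "leval xs \<in> O[at 0](\<lambda>_. 1)"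
proof -
  have "isCont (leval xs) 0"
    by (induction xs) (auto intro!: continuous_intros)
  hence "(leval xs \<longlongrightarrow> leval xs 0) (at 0)"
    by (simp add: isCont_def)
  thus ?thesis
    by (intro bigoI_tendsto[of _ _ "leval xs 0"]) simp_all
qed

definition trunc_eq :: "nat \<Rightarrow> (complex \<Rightarrow> complex) \<Rightarrow> int list \<Rightarrow> bool" where
  "trunc_eq n f xs \<longleftrightarrow> (\<lambda>q. f q - leval xs q) \<in> O[at 0](\<lambda>q. q ^ n)"

lemma power_O_power_at_0: "m \<ge> n \<Longrightarrow> (\<lambda>q::complex. q ^ m) \<in> O[at 0](\<lambda>q. q ^ n)"
proof (rule bigoI[of _ 1])
  assume "m \<ge> n"
  have "eventually (\<lambda>q::complex. norm q \<le> 1) (at 0)"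
    unfolding eventually_at by (rule exI[of _ 1]) auto
  thus "eventually (\<lambda>q::complex. norm (q ^ m) \<le> 1 * norm (q ^ n)) (at 0)"
    by eventually_elim (use \<open>m \<ge> n\<close> in \<open>auto simp: norm_power intro: power_decreasing\<close>)
qed

lemma trunc_eq_take:
  assumes "trunc_eq n f xs"
  shows "trunc_eq n f (take n xs)"
proof (cases "length xs \<le> n")
  case False
  have "(\<lambda>q. q ^ n * leval (drop n xs) q) \<in> O[at 0](\<lambda>q. q ^ n * 1)"
    by (intro landau_o.big.mult leval_O_1) auto
  hence "(\<lambda>q. (f q - leval xs q) + q ^ n * leval (drop n xs) q) \<in> O[at 0](\<lambda>q. q ^ n)"
    using assms by (intro sum_in_bigo(1)) (simp_all add: trunc_eq_def)
  also have "(\<lambda>q. (f q - leval xs q) + q ^ n * leval (drop n xs) q) = (\<lambda>q. f q - leval (take n xs) q)"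
    using leval_append[of "take n xs" "drop n xs"] False by (auto simp: fun_eq_iff)
  finally show ?thesis by (simp add: trunc_eq_def)
qed (use assms in simp)

lemma trunc_eq_list: "trunc_eq n (leval xs) xs"
  by (simp add: trunc_eq_def)

lemma trunc_eq_add:
  assumes "trunc_eq n f xs" "trunc_eq n g ys"
  shows "trunc_eq n (\<lambda>q. f q + g q) (ladd xs ys)"
proof -
  have "(\<lambda>q. (f q - leval xs q) + (g q - leval ys q)) \<in> O[at 0](\<lambda>q. q ^ n)"
    using assms by (intro sum_in_bigo(1)) (simp_all add: trunc_eq_def)
  thus ?thesis by (simp add: trunc_eq_def leval_ladd algebra_simps)
qed

lemma trunc_eq_O_1:
  assumes "trunc_eq n f xs"
  shows "f \<in> O[at 0](\<lambda>_. 1)"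
proof -
  have "(\<lambda>q. f q - leval xs q) \<in> O[at 0](\<lambda>q. q ^ 0)"
    using assms landau_o.big.trans[OF _ power_O_power_at_0[of 0 n]] by (simp add: trunc_eq_def)
  hence "(\<lambda>q. (f q - leval xs q) + leval xs q) \<in> O[at 0](\<lambda>_. 1)"
    using leval_O_1 by (intro sum_in_bigo(1)) simp_all
  thus ?thesis by simp
qed

lemma trunc_eq_mult:
  assumes "trunc_eq n f xs" "trunc_eq n g ys"
  shows "trunc_eq n (\<lambda>q. f q * g q) (take n (lmul xs ys))"
proof (rule trunc_eq_take)
  have "(\<lambda>q. (f q - leval xs q) * g q) \<in> O[at 0](\<lambda>q. q ^ n * 1)"
    using assms by (intro landau_o.big.mult trunc_eq_O_1[OF assms(2)]) (simp add: trunc_eq_def)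
  moreover have "(\<lambda>q. leval xs q * (g q - leval ys q)) \<in> O[at 0](\<lambda>q. 1 * q ^ n)"
    using assms by (intro landau_o.big.mult leval_O_1) (simp add: trunc_eq_def)
  ultimately have "(\<lambda>q. (f q - leval xs q) * g q + leval xs q * (g q - leval ys q)) \<in> O[at 0](\<lambda>q. q ^ n)"
    by (intro sum_in_bigo(1)) simp_all
  thus "trunc_eq n (\<lambda>q. f q * g q) (lmul xs ys)"
    by (simp add: trunc_eq_def leval_lmul algebra_simps)
qed

fun lpow :: "nat \<Rightarrow> int list \<Rightarrow> nat \<Rightarrow> int list" where
  "lpow n xs 0 = [1]"
| "lpow n xs (Suc m) = take n (lmul xs (lpow n xs m))"

lemma trunc_eq_power:
  assumes "trunc_eq n f xs"
  shows "trunc_eq n (\<lambda>q. f q ^ m) (lpow n xs m)"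
proof (induction m)
  case 0
  show ?case by (simp add: trunc_eq_def)
next
  case (Suc m)
  show ?case using trunc_eq_mult[OF assms Suc] by simp
qed

lemma trunc_eq_const: "trunc_eq n (\<lambda>_. of_int c) [c]"
  by (simp add: trunc_eq_def)

lemma trunc_eq_monom: "trunc_eq n (\<lambda>q. q ^ m) (replicate m 0 @ [1])"
  by (simp add: trunc_eq_def leval_append)

lemma trunc_eq_uminus:
  assumes "trunc_eq n f xs"
  shows "trunc_eq n (\<lambda>q. - f q) (map ((*) (-1)) xs)"
proof -
  have "(\<lambda>q. - (f q - leval xs q)) \<in> O[at 0](\<lambda>q. q ^ n)"
    using assms by (simp only: trunc_eq_def landau_o.big.uminus_in_iff)
  thus ?thesis by (simp add: trunc_eq_def leval_smult)
qed

text \<open>The list \<open>ys\<close> is a certificate checked by one truncated multiplication. As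
  \<open>f\<close> tends to 1, its inverse is bounded near 0, and
  \<open>1 / f - ys = - (1 / f) * (f * ys - 1)\<close> bounds the error.\<close>

lemma trunc_eq_inverse:
  assumes f: "trunc_eq n f xs" and lim: "(f \<longlongrightarrow> 1) (at 0)" and n: "n > 0"
    and ys: "take n (lmul xs ys) = take n (1 # replicate (n - 1) 0)"
  shows "trunc_eq n (\<lambda>q. inverse (f q)) ys"
proof -
  have "trunc_eq n (\<lambda>q. f q * leval ys q) (take n (1 # replicate (n - 1) 0))"
    using trunc_eq_mult[OF f trunc_eq_list[of n ys]] ys by simp
  hence "(\<lambda>q. f q * leval ys q - 1) \<in> O[at 0](\<lambda>q. q ^ n)"
    using n by (simp add: trunc_eq_def take_Cons')
  moreover have inv: "(\<lambda>q. inverse (f q)) \<in> O[at 0](\<lambda>_. 1)"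
  proof -
    have "((\<lambda>q. inverse (f q)) \<longlongrightarrow> inverse 1) (at 0)"
      by (intro tendsto_intros lim) auto
    thus ?thesis by (intro bigoI_tendsto[of _ _ 1]) simp_all
  qed
  ultimately have O: "(\<lambda>q. - (inverse (f q) * (f q * leval ys q - 1))) \<in> O[at 0](\<lambda>q. 1 * q ^ n)"
    unfolding landau_o.big.uminus_in_iff by (intro landau_o.big.mult)
  have "eventually (\<lambda>q. f q \<noteq> 0) (at 0)"
    using lim by (rule tendsto_imp_eventually_ne) auto
  hence "eventually (\<lambda>q. - (inverse (f q) * (f q * leval ys q - 1)) = inverse (f q) - leval ys q) (at 0)"
    by eventually_elim (simp add: field_simps)
  from landau_o.big.in_cong[OF this] O show ?thesis
    by (simp add: trunc_eq_def)
qed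

text \<open>This controls the tail of an Euler product. A geometric series bounds the exponent by
  \<open>2 * norm a\<close>, and \<open>exp x \<le> 1 + x + x ^ 2\<close> for
  \<open>0 \<le> x \<le> 1\<close> yields the constant 4.\<close>

lemma qp_minus_1_bound:
  assumes "norm q \<le> 1/2" and "norm a \<le> 1/2"
  shows "norm (qp a q - 1) \<le> 4 * norm a"
proof -
  have q: "norm q < 1" using assms by simp
  have "norm ((\<Prod>k<n. 1 - a * q ^ k) - 1) \<le> 4 * norm a" for n
  proof -
    have "norm ((\<Prod>k<n. 1 - a * q ^ k) - 1) \<le> (\<Prod>k<n. 1 + norm (- (a * q ^ k))) - 1"
      using norm_prod_minus1_le_prod_minus1[of "\<lambda>k. - (a * q ^ k)" "{..<n}"] by simp
    also have "(\<Prod>k<n. 1 + norm (- (a * q ^ k))) \<le> exp (\<Sum>k<n. norm (- (a * q ^ k)))"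
      by (rule prod_le_exp_sum) auto
    also have "(\<Sum>k<n. norm (- (a * q ^ k))) \<le> 2 * norm a"
    proof -
      have "(\<Sum>k<n. norm (- (a * q ^ k))) \<le> (\<Sum>k<n. norm a * (1/2) ^ k)"
        using assms by (intro sum_mono) (auto simp: norm_mult norm_power intro!: mult_left_mono power_mono)
      also have "\<dots> = norm a * (\<Sum>k<n. (1/2) ^ k)"
        by (simp add: sum_distrib_left)
      also have "\<dots> \<le> norm a * 2"
        by (intro mult_left_mono) (simp_all add: sum_gp_strict)
      finally show ?thesis by simp
    qed
    also have "exp (2 * norm a) \<le> 1 + 2 * norm a + (2 * norm a)\<^sup>2"
      using assms by (intro exp_bound) auto
    also have "(2 * norm a)\<^sup>2 \<le> 2 * norm a"
      using mult_left_mono[of "2 * norm a" 1 "2 * norm a"] assms by (simp add: power2_eq_square)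
    finally show ?thesis by simp
  qed
  moreover have "(\<lambda>n. norm ((\<Prod>k<n. 1 - a * q ^ k) - 1)) \<longlonglongrightarrow> norm (qp a q - 1)"
    by (intro tendsto_intros qp_tendsto q)
  ultimately show ?thesis
    by (meson LIMSEQ_le_const2)
qed

text \<open>Coefficients modulo \<open>q ^ n\<close> of the first \<open>m\<close> factors of the
  Euler product in \<open>q ^ k\<close>.\<close>

fun leuler :: "nat \<Rightarrow> nat \<Rightarrow> nat \<Rightarrow> int list" where
  "leuler n k 0 = [1]"
| "leuler n k (Suc m) = take n (lmul (leuler n k m) (ladd [1] (map ((*) (-1)) (replicate (k * Suc m) 0 @ [1]))))"

text \<open>The first \<open>m\<close> factors are expanded exactly, and the tail is
  \<open>1 + O(q ^ (k * Suc m))\<close>; it accounts for the factor \<open>[1]\<close>.\<close>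

lemma trunc_eq_euler:
  assumes "k > 0" and "n \<le> k * Suc m"
  shows "trunc_eq n (\<lambda>q. qp (q ^ k) (q ^ k)) (take n (lmul (leuler n k m) [1]))"
proof -
  have ev: "eventually (\<lambda>q::complex. norm q \<le> 1/2) (at 0)"
    unfolding eventually_at by (rule exI[of _ "1/2"]) auto
  have small: "norm (q ^ l) \<le> 1/2" if "norm q \<le> 1/2" "l > 0" for q :: complex and l
    using power_decreasing[of 1 l "norm q"] that by (simp add: norm_power)
  have "trunc_eq n (\<lambda>q. \<Prod>j<m. 1 - q ^ k * (q ^ k) ^ j) (leuler n k m)" for m
  proof (induction m)
    case (Suc m)
    have "trunc_eq n (\<lambda>q. 1 + (- (q ^ (k * Suc m)))) (ladd [1] (map ((*) (-1)) (replicate (k * Suc m) 0 @ [1])))"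
      using trunc_eq_add[OF trunc_eq_const[of n 1] trunc_eq_uminus[OF trunc_eq_monom[of n "k * Suc m"]]] by simp
    from trunc_eq_mult[OF Suc.IH this] show ?case
      by (simp add: power_mult [symmetric] power_add [symmetric])
  qed (simp add: trunc_eq_def)
  moreover have "trunc_eq n (\<lambda>q. qp (q ^ k * (q ^ k) ^ m) (q ^ k)) [1]"
  proof -
    have "(\<lambda>q::complex. qp (q ^ (k * Suc m)) (q ^ k) - 1) \<in> O[at 0](\<lambda>q. q ^ (k * Suc m))"
    proof (rule bigoI[of _ 4])
      show "eventually (\<lambda>q::complex. norm (qp (q ^ (k * Suc m)) (q ^ k) - 1) \<le> 4 * norm (q ^ (k * Suc m))) (at 0)"
        using ev by eventually_elim (use assms(1) in \<open>intro qp_minus_1_bound small; simp\<close>)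
    qed
    from landau_o.big.trans[OF this power_O_power_at_0[OF assms(2)]] show ?thesis
      by (simp add: trunc_eq_def power_mult [symmetric] power_add [symmetric])
  qed
  ultimately have *: "trunc_eq n (\<lambda>q. (\<Prod>j<m. 1 - q ^ k * (q ^ k) ^ j) * qp (q ^ k * (q ^ k) ^ m) (q ^ k))
      (take n (lmul (leuler n k m) [1]))"
    by (rule trunc_eq_mult)
  have "eventually (\<lambda>q. (\<Prod>j<m. 1 - q ^ k * (q ^ k) ^ j) * qp (q ^ k * (q ^ k) ^ m) (q ^ k) = qp (q ^ k) (q ^ k)) (at 0)"
    using ev
  proof eventually_elim
    case (elim q)
    have "norm (q ^ k) < 1"
      using small[OF elim assms(1)] by simp
    thus ?case
      by (rule qp_split_initial [symmetric])
  qed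
  hence "eventually (\<lambda>q. (\<Prod>j<m. 1 - q ^ k * (q ^ k) ^ j) * qp (q ^ k * (q ^ k) ^ m) (q ^ k) -
      leval (take n (lmul (leuler n k m) [1])) q =
      qp (q ^ k) (q ^ k) - leval (take n (lmul (leuler n k m) [1])) q) (at 0)"
    by (rule eventually_mono) (simp only:)
  from landau_o.big.in_cong[OF this] * show ?thesis
    by (simp only: trunc_eq_def)
qed

lemma euler_tendsto_1: "((\<lambda>q. qp (q ^ k) (q ^ k)) \<longlongrightarrow> 1) (at 0)" if "k > 0"
proof -
  have "(\<lambda>q. qp (q ^ k) (q ^ k)) holomorphic_on ball 0 1"
    using that by (intro holomorphic_intros) (auto simp: norm_power power_less_one_iff)
  hence "isCont (\<lambda>q. qp (q ^ k) (q ^ k)) 0"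
    using holomorphic_on_imp_continuous_on continuous_on_eq_continuous_at open_ball
    by (metis centre_in_ball zero_less_one)
  thus ?thesis using that by (simp add: isCont_def power_0_left)
qed

section \<open>Expansions at the cusps\<close>

lemma trunc_eq_ident: "trunc_eq n (\<lambda>q. q) [0, 1]"
  by (simp add: trunc_eq_def)

lemma trunc_eq_numeral: "trunc_eq n (\<lambda>_. numeral k) [numeral k]"
  using trunc_eq_const[of n "numeral k"] by simp

lemma trunc_eq_diff:
  assumes "trunc_eq n f xs" "trunc_eq n g ys"
  shows "trunc_eq n (\<lambda>q. f q - g q) (ladd xs (map ((*) (-1)) ys))"
  using trunc_eq_add[OF assms(1) trunc_eq_uminus[OF assms(2)]] by simp

lemma trunc_eq_list_cong: "trunc_eq n f xs \<Longrightarrow> xs = ys \<Longrightarrow> trunc_eq n f ys"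
  by simp

lemmas trunc_eq_intros = trunc_eq_ident trunc_eq_numeral trunc_eq_diff trunc_eq_uminus trunc_eq_add
  trunc_eq_mult trunc_eq_power

abbreviation euler :: "nat \<Rightarrow> complex \<Rightarrow> complex" where
  "euler k q \<equiv> qp (q ^ k) (q ^ k)"

abbreviation inv_euler :: "nat \<Rightarrow> complex \<Rightarrow> complex" where
  "inv_euler k q \<equiv> inverse (qp (q ^ k) (q ^ k))"

text \<open>Precision 10 is one more than the power \<open>q ^ 9\<close> that clears the poles at
  infinity, so it can detect vanishing there. The numbers of factors 9, 4, 0, 0 are the least that
  reach it.\<close>

lemma trunc_eq_euler_base:
  "trunc_eq 10 (\<lambda>q. euler 1 q) [1, -1, -1, 0, 0, 1, 0, 1, 0, 0]"
  "trunc_eq 10 (\<lambda>q. euler 2 q) [1, 0, -1, 0, -1, 0, 0, 0, 0, 0]"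
  "trunc_eq 10 (\<lambda>q. euler 13 q) [1]"
  "trunc_eq 10 (\<lambda>q. euler 26 q) [1]"
proof -
  show "trunc_eq 10 (\<lambda>q. euler 1 q) [1, -1, -1, 0, 0, 1, 0, 1, 0, 0]"
    by (rule trunc_eq_list_cong, rule trunc_eq_euler[of 1 10 9], simp, simp, code_simp)
  show "trunc_eq 10 (\<lambda>q. euler 2 q) [1, 0, -1, 0, -1, 0, 0, 0, 0, 0]"
    by (rule trunc_eq_list_cong, rule trunc_eq_euler[of 2 10 4], simp, simp, code_simp)
  show "trunc_eq 10 (\<lambda>q. euler 13 q) [1]"
    by (rule trunc_eq_list_cong, rule trunc_eq_euler[of 13 10 0], simp, simp, code_simp)
  show "trunc_eq 10 (\<lambda>q. euler 26 q) [1]"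
    by (rule trunc_eq_list_cong, rule trunc_eq_euler[of 26 10 0], simp, simp, code_simp)
qed

lemma trunc_eq_inv_euler_base:
  "trunc_eq 10 (\<lambda>q. inv_euler 1 q) [1, 1, 2, 3, 5, 7, 11, 15, 22, 30]"
  "trunc_eq 10 (\<lambda>q. inv_euler 2 q) [1, 0, 1, 0, 2, 0, 3, 0, 5, 0]"
  "trunc_eq 10 (\<lambda>q. inv_euler 13 q) [1, 0, 0, 0, 0, 0, 0, 0, 0, 0]"
  "trunc_eq 10 (\<lambda>q. inv_euler 26 q) [1, 0, 0, 0, 0, 0, 0, 0, 0, 0]"
  by (rule trunc_eq_inverse trunc_eq_euler_base euler_tendsto_1 | code_simp)+

text \<open>Multiples of \<open>u\<^sup>2\<close>, \<open>B u\<close> and \<open>B\<^sup>2\<close> by powers of \<open>q\<close> that clear the poles at the cusps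
  infinity and 0; \<open>u\<^sup>2\<close> has the same expansion at both.\<close>

definition scaled_u2 :: "complex \<Rightarrow> complex" where
  "scaled_u2 q = 2 * q - (euler 2 q * euler 13 q * inv_euler 1 q * inv_euler 26 q) ^ 2
           - q ^ 2 * (inv_euler 2 q * inv_euler 13 q * euler 1 q * euler 26 q) ^ 2"

lemma trunc_eq_scaled_u2: "trunc_eq 10 scaled_u2 [-1, 0, -4, -4, -10, -12, -26, -28, -51, -60]"
  unfolding scaled_u2_def
  by (rule trunc_eq_list_cong, (rule trunc_eq_intros trunc_eq_euler_base trunc_eq_inv_euler_base)+, code_simp)

definition scaled_Bu_inf :: "complex \<Rightarrow> complex" where
  "scaled_Bu_inf q = - (euler 2 q ^ 6 * euler 13 q ^ 2 * inv_euler 1 q ^ 2 * inv_euler 26 q ^ 6)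
    + q * (euler 2 q ^ 4 * inv_euler 26 q ^ 4)
    - 169 * q ^ 10 * (inv_euler 2 q ^ 6 * inv_euler 13 q ^ 2 * euler 1 q ^ 2 * euler 26 q ^ 6)
    + 169 * q ^ 9 * (inv_euler 2 q ^ 4 * euler 26 q ^ 4)"

definition scaled_B2_inf :: "complex \<Rightarrow> complex" where
  "scaled_B2_inf q = - (euler 2 q ^ 10 * euler 13 q ^ 2 * inv_euler 1 q ^ 2 * inv_euler 26 q ^ 10)
    + 338 * q ^ 9 - 28561 * q ^ 18 * (inv_euler 2 q ^ 10 * inv_euler 13 q ^ 2 * euler 1 q ^ 2 * euler 26 q ^ 10)"

definition scaled_Bu_0 :: "complex \<Rightarrow> complex" where
  "scaled_Bu_0 q = - (169 * q ^ 3 * (euler 13 q ^ 6 * euler 2 q ^ 2 * inv_euler 26 q ^ 2 * inv_euler 1 q ^ 6))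
    + 169 * q ^ 4 * (euler 13 q ^ 4 * inv_euler 1 q ^ 4)
    - q * (inv_euler 13 q ^ 6 * inv_euler 2 q ^ 2 * euler 26 q ^ 2 * euler 1 q ^ 6)
    + inv_euler 13 q ^ 4 * euler 1 q ^ 4"

definition scaled_B2_0 :: "complex \<Rightarrow> complex" where
  "scaled_B2_0 q = - (28561 * q ^ 9 * (euler 13 q ^ 10 * euler 2 q ^ 2 * inv_euler 26 q ^ 2 * inv_euler 1 q ^ 10))
    + 338 * q ^ 6 - q ^ 3 * (inv_euler 13 q ^ 10 * inv_euler 2 q ^ 2 * euler 26 q ^ 2 * euler 1 q ^ 10)"

lemma trunc_eq_scaled_Bu_inf: "trunc_eq 10 scaled_Bu_inf [-1, -1, 1, -2, 1, 8, 0, 4, 5, 160]"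
  unfolding scaled_Bu_inf_def
  by (rule trunc_eq_list_cong, (rule trunc_eq_intros trunc_eq_euler_base trunc_eq_inv_euler_base)+, code_simp)

lemma trunc_eq_scaled_B2_inf: "trunc_eq 10 scaled_B2_inf [-1, -2, 5, 10, -5, -6, -10, -40, 20, 388]"
  unfolding scaled_B2_inf_def
  by (rule trunc_eq_list_cong, (rule trunc_eq_intros trunc_eq_euler_base trunc_eq_inv_euler_base)+, code_simp)

lemma trunc_eq_scaled_Bu_0: "trunc_eq 10 scaled_Bu_0 [1, -5, 8, -172, -848, -3546, -12168, -37178, -103282, -267847]"
  unfolding scaled_Bu_0_def
  by (rule trunc_eq_list_cong, (rule trunc_eq_intros trunc_eq_euler_base trunc_eq_inv_euler_base)+, code_simp)

lemma trunc_eq_scaled_B2_0: "trunc_eq 10 scaled_B2_0 [0, 0, 0, -1, 10, -37, 388, 30, -128, -28536]"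
  unfolding scaled_B2_0_def
  by (rule trunc_eq_list_cong, (rule trunc_eq_intros trunc_eq_euler_base trunc_eq_inv_euler_base)+, code_simp)

text \<open>The relation made homogeneous: if \<open>v\<close>, \<open>w\<close>, \<open>y\<close>
  carry the factors \<open>q\<close>, \<open>q ^ (m + 2)\<close>, \<open>q ^ (m + 6)\<close>, then
  every term carries \<open>q ^ (m + 6)\<close>. The choice is \<open>m = 3\<close> at infinity and
  \<open>m = 0\<close> at the cusp 0.\<close>

definition scaled_relation :: "nat \<Rightarrow> complex \<Rightarrow> complex \<Rightarrow> complex \<Rightarrow> complex \<Rightarrow> complex" where
  "scaled_relation m q y w v = y - w * (v ^ 4 - q * v ^ 3 - 21 * q ^ 2 * v ^ 2 + 35 * q ^ 3 * v + 30 * q ^ 4)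
     + q ^ m * (v ^ 6 + 4 * q * v ^ 5 - 26 * q ^ 2 * v ^ 4 + 89 * q ^ 3 * v ^ 3 - 829 * q ^ 4 * v ^ 2
                + 1821 * q ^ 5 * v - 576 * q ^ 6)"

text \<open>The computational core: all ten coefficients cancel, so the relation tends to 0 at
  infinity even after division by \<open>q ^ 9\<close>.\<close>

lemma trunc_eq_scaled_relation_inf: "trunc_eq 10 (\<lambda>q. scaled_relation 3 q (scaled_B2_inf q) (scaled_Bu_inf q) (scaled_u2 q)) (replicate 10 0)"
  unfolding scaled_relation_def
  by (rule trunc_eq_list_cong, (rule trunc_eq_intros trunc_eq_scaled_B2_inf trunc_eq_scaled_Bu_inf trunc_eq_scaled_u2)+, code_simp)

lemma trunc_eq_scaled_relation_0: "trunc_eq 10 (\<lambda>q. scaled_relation 0 q (scaled_B2_0 q) (scaled_Bu_0 q) (scaled_u2 q)) (replicate 10 0)"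
  unfolding scaled_relation_def
  by (rule trunc_eq_list_cong, (rule trunc_eq_intros trunc_eq_scaled_B2_0 trunc_eq_scaled_Bu_0 trunc_eq_scaled_u2)+, code_simp)

lemma scaled_relation_eq:
  assumes v: "v = q * (p / c\<^sup>2 + 2 + c\<^sup>2 / p)"
    and w: "w = q ^ (m + 2) * (p + c\<^sup>2 + 169 / p + 169 / c\<^sup>2)"
    and y: "y = q ^ (m + 6) * (p * c\<^sup>2 + 338 + 28561 / (p * c\<^sup>2))"
  shows "scaled_relation m q y w v = q ^ (m + 6) * modular_relation p c"
proof -
  define a where "a = p / c\<^sup>2 + 2 + c\<^sup>2 / p"
  have 1: "(q * a) ^ 4 - q * (q * a) ^ 3 - 21 * q ^ 2 * (q * a) ^ 2 + 35 * q ^ 3 * (q * a) + 30 * q ^ 4 =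
      q ^ 4 * (a ^ 4 - a ^ 3 - 21 * a ^ 2 + 35 * a + 30)"
    by algebra
  have 2: "(q * a) ^ 6 + 4 * q * (q * a) ^ 5 - 26 * q ^ 2 * (q * a) ^ 4 + 89 * q ^ 3 * (q * a) ^ 3
      - 829 * q ^ 4 * (q * a) ^ 2 + 1821 * q ^ 5 * (q * a) - 576 * q ^ 6 =
      q ^ 6 * (a ^ 6 + 4 * a ^ 5 - 26 * a ^ 4 + 89 * a ^ 3 - 829 * a ^ 2 + 1821 * a - 576)"
    by algebra
  have 3: "q ^ (m + 2) * z * (q ^ 4 * z') = q ^ (m + 6) * (z * z')" for z z'
    by (simp add: power_add mult_ac power_numeral_reduce)
  have 4: "q ^ m * (q ^ 6 * z) = q ^ (m + 6) * z" for z
    by (simp add: power_add mult_ac)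
  have 5: "z * y - z * (w * x) + z * (t1 + t2 - t3 + t4 - t5 + t6 - t7) =
      z * (y - w * x + t1 + t2 - t3 + t4 - t5 + t6 - t7)" for z y w x t1 t2 t3 t4 t5 t6 t7 :: complex
    by (simp add: algebra_simps)
  show ?thesis
    unfolding scaled_relation_def modular_relation_def Let_def v w y a_def [symmetric] 1 2 3 4
    by (rule 5)
qed

text \<open>Here \<open>a\<close>, \<open>b\<close>, \<open>c\<close>, \<open>d\<close> stand for
  the Euler products at 1, 2, 13, 26. The identities bring the terms of
  \<open>modular_relation\<close> into the shape of the scaled functions at infinity.\<close>

lemma quotient_algebra_inf:
  fixes q a b c d :: complex
  assumes nz: "q \<noteq> 0" "a \<noteq> 0" "b \<noteq> 0" "c \<noteq> 0" "d \<noteq> 0"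
    and A: "A = b ^ 6 * c ^ 2 / (a ^ 2 * d ^ 6) / q ^ 5"
    and C: "C = b ^ 2 / d ^ 2 / q ^ 2"
  shows "A / C ^ 2 = (b * c * inverse a * inverse d) ^ 2 / q"
    and "C ^ 2 / A = q * (inverse b * inverse c * a * d) ^ 2"
    and "C ^ 2 = b ^ 4 * inverse d ^ 4 / q ^ 4"
    and "A = b ^ 6 * c ^ 2 * inverse a ^ 2 * inverse d ^ 6 / q ^ 5"
    and "1 / C ^ 2 = q ^ 4 * (inverse b ^ 4 * d ^ 4)"
    and "1 / A = q ^ 5 * (inverse b ^ 6 * inverse c ^ 2 * a ^ 2 * d ^ 6)"
    and "A * C ^ 2 = b ^ 10 * c ^ 2 * inverse a ^ 2 * inverse d ^ 10 / q ^ 9"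
    and "1 / (A * C ^ 2) = q ^ 9 * (inverse b ^ 10 * inverse c ^ 2 * a ^ 2 * d ^ 10)"
  unfolding A C using nz by (simp_all add: divide_simps power_mult_distrib power_divide power_mult [symmetric])
    (simp_all add: power_numeral_reduce mult_ac)

text \<open>The analogue at the cusp 0. The constants come from the inversion factors:
  \<open>13 ^ 3 * 2 / 26 = 169\<close> for \<open>A\<close> and \<open>13 / 1 = 13\<close> for
  \<open>C\<close>.\<close>

lemma quotient_algebra_0:
  fixes q a b c d :: complex
  assumes nz: "q \<noteq> 0" "a \<noteq> 0" "b \<noteq> 0" "c \<noteq> 0" "d \<noteq> 0"
    and A: "A = 169 * q * (c ^ 6 * b ^ 2 / (d ^ 2 * a ^ 6))"
    and C: "C = 13 * q * (c ^ 2 / a ^ 2)"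
  shows "A / C ^ 2 = (b * c * inverse a * inverse d) ^ 2 / q"
    and "C ^ 2 / A = q * (inverse b * inverse c * a * d) ^ 2"
    and "C ^ 2 = 169 * q ^ 2 * (c ^ 4 * inverse a ^ 4)"
    and "A = 169 * q * (c ^ 6 * b ^ 2 * inverse d ^ 2 * inverse a ^ 6)"
    and "1 / C ^ 2 = inverse c ^ 4 * a ^ 4 / (169 * q ^ 2)"
    and "1 / A = inverse c ^ 6 * inverse b ^ 2 * d ^ 2 * a ^ 6 / (169 * q)"
    and "A * C ^ 2 = 28561 * q ^ 3 * (c ^ 10 * b ^ 2 * inverse d ^ 2 * inverse a ^ 10)"
    and "1 / (A * C ^ 2) = inverse c ^ 10 * inverse b ^ 2 * d ^ 2 * a ^ 10 / (28561 * q ^ 3)"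
  unfolding A C using nz by (simp_all add: divide_simps power_mult_distrib power_divide power_mult [symmetric])
    (simp_all add: power_numeral_reduce mult_ac)?

section \<open>Eta quotients as series in \<open>q\<close>\<close>

lemma eta2_q_expansion:
  "eta2 (of_nat n * \<tau>) = qpow \<tau> (1/12) ^ n * euler n (qpow \<tau> 1) ^ 2"
  using qpow_scale[of "real n" \<tau>] by (simp add: eta2_def qpow_power)

text \<open>In the parameter \<open>t\<close> with \<open>\<tau> = -1 / (26 * t)\<close> the
  inversion exchanges complementary divisors of 26, so the same four Euler products describe the
  cusp 0.\<close>

lemma eta2_at_0:
  assumes "Im t > 0" and "m > 0" and "n * m = 26"
  shows "eta2 (of_nat n * (-1 / (26 * t))) = - \<i> * of_nat m * t * eta2 (of_nat m * t)"
proof -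
  have "of_nat n * of_nat m = (26 :: complex)"
    using assms(3) by (metis of_nat_mult of_nat_numeral)
  hence "of_nat n * (-1 / (26 * t)) = -1 / (of_nat m * t)"
    using assms by (auto simp: divide_simps)
  thus ?thesis
    using eta2_S[of "of_nat m * t"] assms by (simp add: mult_ac)
qed

lemma etaA_etaC_q_expansion:
  assumes "Im \<tau> > 0"
  defines "q \<equiv> qpow \<tau> 1"
  shows "etaA \<tau> = euler 2 q ^ 6 * euler 13 q ^ 2 / (euler 1 q ^ 2 * euler 26 q ^ 6) / q ^ 5"
    and "etaC \<tau> = euler 2 q ^ 2 / euler 26 q ^ 2 / q ^ 2"
proof -
  define x where "x = qpow \<tau> (1/12)"
  have q: "norm q < 1" and q0: "q \<noteq> 0" and x0: "x \<noteq> 0" and xq: "q = x ^ 12"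
    using norm_qpow_less_1[OF assms(1), of 1] by (simp_all add: q_def x_def qpow_power)
  have nz: "euler k q \<noteq> 0" if "k > 0" for k
    using q that by (intro qp_same_nonzero) (simp add: norm_power power_less_one_iff)
  \<comment> \<open>Leading exponents in units of 1/12: \<open>3 * 2 + 13 - 1 - 3 * 26 = -60\<close>
    for \<open>etaA\<close> and \<open>2 - 26 = -24\<close> for \<open>etaC\<close>, which are the
    poles \<open>q ^ 5\<close> and \<open>q ^ 2\<close>.\<close>
  have x79: "x * x ^ 78 = x ^ 19 * q ^ 5" and x26: "x ^ 26 = x ^ 2 * q ^ 2"
    by (simp_all add: xq flip: power_mult power_add power_Suc)
  show "etaA \<tau> = euler 2 q ^ 6 * euler 13 q ^ 2 / (euler 1 q ^ 2 * euler 26 q ^ 6) / q ^ 5"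
    using eta2_q_expansion[of 1 \<tau>] eta2_q_expansion[of 2 \<tau>] eta2_q_expansion[of 13 \<tau>] eta2_q_expansion[of 26 \<tau>]
      q0 x0 nz[of 1] nz[of 2] nz[of 13] nz[of 26]
    unfolding etaA_def by (simp add: q_def [symmetric] x_def [symmetric] power_mult_distrib divide_simps x79 flip: power_mult power_add)
  show "etaC \<tau> = euler 2 q ^ 2 / euler 26 q ^ 2 / q ^ 2"
    using eta2_q_expansion[of 2 \<tau>] eta2_q_expansion[of 26 \<tau>] x0 nz[of 2] nz[of 26]
    unfolding etaC_def by (simp add: q_def [symmetric] x_def [symmetric] divide_simps x26)
qed

lemma relation_fun_scaled_inf:
  assumes "Im \<tau> > 0"
  defines "q \<equiv> qpow \<tau> 1"
  shows "scaled_relation 3 q (scaled_B2_inf q) (scaled_Bu_inf q) (scaled_u2 q) = q ^ 9 * relation_fun \<tau>"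
proof -
  have q: "norm q < 1" and q0: "q \<noteq> 0"
    using norm_qpow_less_1[OF assms(1), of 1] by (simp_all add: q_def)
  have nz: "euler k q \<noteq> 0" if "k > 0" for k
    using q that by (intro qp_same_nonzero) (simp add: norm_power power_less_one_iff)
  note A = etaA_etaC_q_expansion(1)[OF assms(1), folded q_def]
  note C = etaA_etaC_q_expansion(2)[OF assms(1), folded q_def]
  note QA = quotient_algebra_inf[OF q0 nz[of 1] nz[of 2] nz[of 13] nz[of 26] A C]
  have "scaled_relation 3 q (scaled_B2_inf q) (scaled_Bu_inf q) (scaled_u2 q) = q ^ (3 + 6) * modular_relation (- etaA \<tau>) (etaC \<tau>)"
  proof (rule scaled_relation_eq)
    show "scaled_u2 q = q * (- etaA \<tau> / (etaC \<tau>)\<^sup>2 + 2 + (etaC \<tau>)\<^sup>2 / (- etaA \<tau>))"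
    proof -
      have "q * (- (X / q) + 2 - q * Y) = 2 * q - X - q ^ 2 * Y" for X Y
        using q0 by (simp add: algebra_simps power2_eq_square)
      thus ?thesis
        by (simp only: scaled_u2_def minus_divide_left [symmetric] minus_divide_right [symmetric] QA(1,2) add_uminus_conv_diff)
    qed
    show "scaled_Bu_inf q = q ^ (3 + 2) * (- etaA \<tau> + (etaC \<tau>)\<^sup>2 + 169 / (- etaA \<tau>) + 169 / (etaC \<tau>)\<^sup>2)"
    proof -
      \<comment> \<open>Generic letters replace the eta quotients, so that only powers of
        \<open>q\<close> have to be cleared.\<close>
      have "q ^ (3 + 2) * (- a + c + 169 / (- a) + 169 / c) = - X + q * Y - 169 * q ^ 10 * X' + 169 * q ^ 9 * Y'"
        if "a = X / q ^ 5" "c = Y / q ^ 4" "1 / a = q ^ 5 * X'" "1 / c = q ^ 4 * Y'" for a c X Y X' Y'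
      proof -
        have "q ^ (3 + 2) * (- a + c + 169 / (- a) + 169 / c) = q ^ 5 * (- a + c - 169 * (1 / a) + 169 * (1 / c))"
          by simp
        also have "\<dots> = q ^ 5 * (- (X / q ^ 5) + Y / q ^ 4 - 169 * (q ^ 5 * X') + 169 * (q ^ 4 * Y'))"
          by (simp only: that(3,4)) (simp only: that(1,2))
        also have "\<dots> = - X + q * Y - 169 * q ^ 10 * X' + 169 * q ^ 9 * Y'"
          using q0 by (simp add: field_simps power_numeral_reduce)
        finally show ?thesis .
      qed
      from this[OF QA(4,3,6,5)] show ?thesis
        by (simp only: scaled_Bu_inf_def)
    qed
    show "scaled_B2_inf q = q ^ (3 + 6) * (- etaA \<tau> * (etaC \<tau>)\<^sup>2 + 338 + 28561 / (- etaA \<tau> * (etaC \<tau>)\<^sup>2))"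
    proof -
      have "q ^ (3 + 6) * (- a * c + 338 + 28561 / (- a * c)) = - X + 338 * q ^ 9 - 28561 * q ^ 18 * X'"
        if "a * c = X / q ^ 9" "1 / (a * c) = q ^ 9 * X'" for a c X X'
      proof -
        have "q ^ (3 + 6) * (- a * c + 338 + 28561 / (- a * c)) = q ^ 9 * (- (a * c) + 338 - 28561 * (1 / (a * c)))"
          by simp
        also have "\<dots> = q ^ 9 * (- (X / q ^ 9) + 338 - 28561 * (q ^ 9 * X'))"
          by (simp only: that(2)) (simp only: that(1))
        also have "\<dots> = - X + 338 * q ^ 9 - 28561 * q ^ 18 * X'"
          using q0 by (simp add: field_simps power_numeral_reduce)
        finally show ?thesis .
      qed
      from this[OF QA(7,8)] show ?thesis
        by (simp only: scaled_B2_inf_def)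
    qed
  qed
  thus ?thesis by (simp add: relation_fun_def)
qed

lemma relation_fun_scaled_0:
  assumes "Im t > 0"
  defines "q \<equiv> qpow t 1" and "\<tau> \<equiv> -1 / (26 * t)"
  shows "scaled_relation 0 q (scaled_B2_0 q) (scaled_Bu_0 q) (scaled_u2 q) = q ^ 6 * relation_fun \<tau>"
proof -
  define x where "x = qpow t (1/12)"
  have q: "norm q < 1" and q0: "q \<noteq> 0" and x0: "x \<noteq> 0" and xq: "q = x ^ 12" and t0: "t \<noteq> 0"
    using norm_qpow_less_1[OF assms(1), of 1] assms(1) by (auto simp: q_def x_def qpow_power)
  have nz: "euler k q \<noteq> 0" if "k > 0" for k
    using q that by (intro qp_same_nonzero) (simp add: norm_power power_less_one_iff)
  \<comment> \<open>At the cusp 0 the exponents are \<open>3 * 13 + 2\<close> against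
    \<open>26 + 3\<close> for \<open>etaA\<close> and 13 against 1 for \<open>etaC\<close>; both
    differ by 12, a simple zero in \<open>q\<close>.\<close>
  have x41: "x ^ 41 = x * (x ^ 28 * q)" and x13: "x ^ 13 = x * q"
    by (simp_all add: xq flip: power_mult power_add power_Suc)
  have e: "eta2 \<tau> = - \<i> * 26 * t * (x ^ 26 * euler 26 q ^ 2)" "eta2 (2 * \<tau>) = - \<i> * 13 * t * (x ^ 13 * euler 13 q ^ 2)"
    "eta2 (13 * \<tau>) = - \<i> * 2 * t * (x ^ 2 * euler 2 q ^ 2)" "eta2 (26 * \<tau>) = - \<i> * t * (x * euler 1 q ^ 2)"
    using eta2_at_0[OF assms(1), of 26 1] eta2_at_0[OF assms(1), of 13 2] eta2_at_0[OF assms(1), of 2 13]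
      eta2_at_0[OF assms(1), of 1 26] eta2_q_expansion[of 1 t] eta2_q_expansion[of 2 t]
      eta2_q_expansion[of 13 t] eta2_q_expansion[of 26 t]
    by (simp_all add: q_def [symmetric] x_def [symmetric] \<tau>_def)
  have C: "etaC \<tau> = 13 * q * (euler 13 q ^ 2 / euler 1 q ^ 2)"
    unfolding etaC_def e using x0 t0 nz[of 1] by (simp add: x13 field_simps)
  have A: "etaA \<tau> = 169 * q * (euler 13 q ^ 6 * euler 2 q ^ 2 / (euler 26 q ^ 2 * euler 1 q ^ 6))"
  proof -
    have "etaA \<tau> = ((- \<i>) ^ 4 * t ^ 4 / ((- \<i>) ^ 4 * t ^ 4)) * (x ^ 41 / x ^ 29) * 169 *
        (euler 13 q ^ 6 * euler 2 q ^ 2 / (euler 26 q ^ 2 * euler 1 q ^ 6))"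
      unfolding etaA_def e using x0 t0 nz[of 1] nz[of 26]
      by (simp add: power_mult_distrib divide_simps flip: power_mult)
    also have "x ^ 41 / x ^ 29 = q"
      using x0 by (simp add: xq divide_simps flip: power_add)
    finally show ?thesis using t0 by simp
  qed
  note QA = quotient_algebra_0[OF q0 nz[of 1] nz[of 2] nz[of 13] nz[of 26] A C]
  have "scaled_relation 0 q (scaled_B2_0 q) (scaled_Bu_0 q) (scaled_u2 q) = q ^ (0 + 6) * modular_relation (- etaA \<tau>) (etaC \<tau>)"
  proof (rule scaled_relation_eq)
    show "scaled_u2 q = q * (- etaA \<tau> / (etaC \<tau>)\<^sup>2 + 2 + (etaC \<tau>)\<^sup>2 / (- etaA \<tau>))"
    proof -
      have "q * (- (X / q) + 2 - q * Y) = 2 * q - X - q ^ 2 * Y" for X Y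
        using q0 by (simp add: algebra_simps power2_eq_square)
      thus ?thesis
        by (simp only: scaled_u2_def minus_divide_left [symmetric] minus_divide_right [symmetric] QA(1,2) add_uminus_conv_diff)
    qed
    show "scaled_Bu_0 q = q ^ (0 + 2) * (- etaA \<tau> + (etaC \<tau>)\<^sup>2 + 169 / (- etaA \<tau>) + 169 / (etaC \<tau>)\<^sup>2)"
    proof -
      have "q ^ (0 + 2) * (- a + c + 169 / (- a) + 169 / c) = - (169 * q ^ 3 * X) + 169 * q ^ 4 * Y - q * X' + Y'"
        if "a = 169 * q * X" "c = 169 * q ^ 2 * Y" "1 / a = X' / (169 * q)" "1 / c = Y' / (169 * q ^ 2)" for a c X Y X' Y'
      proof -
        have "q ^ (0 + 2) * (- a + c + 169 / (- a) + 169 / c) = q ^ 2 * (- a + c - 169 * (1 / a) + 169 * (1 / c))"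
          by (simp add: power2_eq_square)
        also have "\<dots> = q ^ 2 * (- (169 * q * X) + 169 * q ^ 2 * Y - 169 * (X' / (169 * q)) + 169 * (Y' / (169 * q ^ 2)))"
          by (simp only: that(3,4)) (simp only: that(1,2))
        also have "\<dots> = - (169 * q ^ 3 * X) + 169 * q ^ 4 * Y - q * X' + Y'"
          using q0 by (simp add: field_simps power_numeral_reduce)
        finally show ?thesis .
      qed
      from this[OF QA(4,3,6,5)] show ?thesis
        by (simp only: scaled_Bu_0_def)
    qed
    show "scaled_B2_0 q = q ^ (0 + 6) * (- etaA \<tau> * (etaC \<tau>)\<^sup>2 + 338 + 28561 / (- etaA \<tau> * (etaC \<tau>)\<^sup>2))"
    proof -
      have "q ^ (0 + 6) * (- a * c + 338 + 28561 / (- a * c)) = - (28561 * q ^ 9 * X) + 338 * q ^ 6 - q ^ 3 * X'"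
        if "a * c = 28561 * q ^ 3 * X" "1 / (a * c) = X' / (28561 * q ^ 3)" for a c X X'
      proof -
        have "q ^ (0 + 6) * (- a * c + 338 + 28561 / (- a * c)) = q ^ 6 * (- (a * c) + 338 - 28561 * (1 / (a * c)))"
          by simp
        also have "\<dots> = q ^ 6 * (- (28561 * q ^ 3 * X) + 338 - 28561 * (X' / (28561 * q ^ 3)))"
          by (simp only: that(2)) (simp only: that(1))
        also have "\<dots> = - (28561 * q ^ 9 * X) + 338 * q ^ 6 - q ^ 3 * X'"
          using q0 by (simp add: field_simps power_numeral_reduce)
        finally show ?thesis .
      qed
      from this[OF QA(7,8)] show ?thesis
        by (simp only: scaled_B2_0_def)
    qed
  qed
  thus ?thesis by (simp add: relation_fun_def)
qed

section \<open>Limits at the cusps and vanishing of the relation\<close>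

lemma trunc_eq_0_tendsto:
  assumes "trunc_eq n f (replicate n 0)" and "m < n"
  shows "((\<lambda>q. f q / q ^ m) \<longlongrightarrow> 0) (at 0)"
proof -
  have "f \<in> O[at 0](\<lambda>q. q ^ n)"
    using assms(1) by (simp add: trunc_eq_def)
  then obtain c where c: "eventually (\<lambda>q. norm (f q) \<le> c * norm (q ^ n)) (at 0)"
    by (rule landau_o.bigE)
  have "eventually (\<lambda>q::complex. q \<noteq> 0) (at 0)"
    by (simp add: eventually_at_filter)
  with c have "eventually (\<lambda>q. norm (f q / q ^ m) \<le> c * norm q ^ (n - m)) (at 0)"
  proof eventually_elim
    case (elim q)
    have "norm (f q) \<le> c * norm q ^ (n - m) * norm q ^ m"
      using elim \<open>m < n\<close> by (simp add: norm_power mult.assoc flip: power_add)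
    thus ?case
      using elim by (simp add: norm_divide norm_power pos_divide_le_eq)
  qed
  moreover have "((\<lambda>q::complex. c * norm q ^ (n - m)) \<longlongrightarrow> c * norm (0::complex) ^ (n - m)) (at 0)"
    by (intro tendsto_intros)
  hence "((\<lambda>q::complex. c * norm q ^ (n - m)) \<longlongrightarrow> 0) (at 0)"
    using \<open>m < n\<close> by (simp add: power_0_left)
  ultimately show ?thesis
    by (rule Lim_null_comparison)
qed

lemma filterlim_qpow_at_cusp: "filterlim (\<lambda>\<tau>. qpow \<tau> 1) (at 0) at_cusp"
proof -
  have Im: "filterlim Im at_top at_cusp"
    unfolding at_cusp_def by (rule filterlim_filtercomap)
  have "((\<lambda>y. exp (- 2 * pi * 1 * y)) \<longlongrightarrow> 0) at_top"
    by real_asymp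
  from filterlim_compose[OF this Im] have "((\<lambda>\<tau>. norm (qpow \<tau> 1)) \<longlongrightarrow> 0) at_cusp"
    unfolding norm_qpow .
  hence "((\<lambda>\<tau>. qpow \<tau> 1) \<longlongrightarrow> 0) at_cusp"
    by (rule tendsto_norm_zero_cancel)
  thus ?thesis
    by (simp add: filterlim_at)
qed

lemma eventually_Im_pos_at_cusp: "eventually (\<lambda>\<tau>. Im \<tau> > 0) at_cusp"
  unfolding eventually_at_cusp by (rule exI[of _ 0]) simp

lemma relation_fun_tendsto_inf: "(relation_fun \<longlongrightarrow> 0) at_cusp"
proof (rule Lim_transform_eventually)
  show "((\<lambda>\<tau>. scaled_relation 3 (qpow \<tau> 1) (scaled_B2_inf (qpow \<tau> 1)) (scaled_Bu_inf (qpow \<tau> 1)) (scaled_u2 (qpow \<tau> 1)) / qpow \<tau> 1 ^ 9)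
      \<longlongrightarrow> 0) at_cusp"
    by (rule filterlim_compose[OF trunc_eq_0_tendsto[OF trunc_eq_scaled_relation_inf] filterlim_qpow_at_cusp]) simp
  show "eventually (\<lambda>\<tau>. scaled_relation 3 (qpow \<tau> 1) (scaled_B2_inf (qpow \<tau> 1)) (scaled_Bu_inf (qpow \<tau> 1)) (scaled_u2 (qpow \<tau> 1)) / qpow \<tau> 1 ^ 9
      = relation_fun \<tau>) at_cusp"
    using eventually_Im_pos_at_cusp by eventually_elim (simp add: relation_fun_scaled_inf)
qed

lemma relation_fun_bounded_0: "eventually (\<lambda>\<tau>. norm (relation_fun (-1 / \<tau>)) \<le> 1) at_cusp"
proof -
  have "((\<lambda>t. scaled_relation 0 (qpow t 1) (scaled_B2_0 (qpow t 1)) (scaled_Bu_0 (qpow t 1)) (scaled_u2 (qpow t 1)) / qpow t 1 ^ 6)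
      \<longlongrightarrow> 0) at_cusp"
    by (rule filterlim_compose[OF trunc_eq_0_tendsto[OF trunc_eq_scaled_relation_0] filterlim_qpow_at_cusp]) simp
  from tendstoD[OF this zero_less_one] eventually_Im_pos_at_cusp
  have "eventually (\<lambda>t. norm (relation_fun (-1 / (26 * t))) \<le> 1) at_cusp"
    by eventually_elim (simp add: relation_fun_scaled_0)
  \<comment> \<open>Substituting \<open>t = \<tau> / 26\<close> turns \<open>-1 / (26 * t)\<close>
    into \<open>-1 / \<tau>\<close>.\<close>
  from eventually_compose_filterlim[OF this filterlim_at_cusp_affine[of "1/26" 0]]
  show ?thesis by simp
qed

theorem relation_fun_eq_0:
  assumes "Im \<tau> > 0"
  shows "relation_fun \<tau> = 0"
  using relation_fun_holomorphic finite_orbit_relation_fun relation_fun_bounded_at_cusps[OF relation_fun_tendsto_inf relation_fun_bounded_0] relation_fun_tendsto_inf assms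
  by (rule SL2_finite_orbit_eq_0)

section \<open>From level 26 back to \<open>P\<close> and \<open>Q\<close>\<close>

lemma euler_minus:
  assumes "norm q < 1"
  shows "qp q q * qp (-q) (-q) * qp (q ^ 4) (q ^ 4) = qp (q\<^sup>2) (q\<^sup>2) ^ 3"
proof -
  have q2: "norm (q\<^sup>2) < 1"
    using assms by (simp add: norm_power power_less_one_iff)
  have "qp q q = qp q (q\<^sup>2) * qp (q\<^sup>2) (q\<^sup>2)"
    using qp_even_odd[OF assms, of q] by (simp add: power2_eq_square)
  moreover have "qp (-q) (-q) = qp (-q) (q\<^sup>2) * qp (q\<^sup>2) (q\<^sup>2)"
    using qp_even_odd[of "-q" "-q"] assms by (simp add: power2_eq_square)
  \<comment> \<open>The odd parts of the two products multiply to \<open>(q ^ 2; q ^ 4)\<close>,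
    which \<open>(q ^ 4; q ^ 4)\<close> completes to \<open>(q ^ 2; q ^ 2)\<close>.\<close>
  moreover have "qp q (q\<^sup>2) * qp (-q) (q\<^sup>2) * qp (q ^ 4) (q ^ 4) = qp (q\<^sup>2) (q\<^sup>2)"
    using qp_mult_minus[OF q2, of q] qp_even_odd[OF q2, of "q\<^sup>2"] by (simp flip: power_mult power_add)
  ultimately show ?thesis
    by (simp add: power3_eq_cube mult_ac)
qed

lemma modular_relation_eq_0D:
  assumes "P \<noteq> 0" "Q \<noteq> 0" and rel: "modular_relation (P\<^sup>2) Q = 0"
    and u: "u = P / Q + Q / P" and B: "B = P * Q + 169 / (P * Q)"
  shows "B ^ 2 = B * (u ^ 9 - u ^ 7 - 21 * u ^ 5 + 35 * u ^ 3 + 30 * u)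
           - u ^ 12 - 4 * u ^ 10 + 26 * u ^ 8 - 89 * u ^ 6 + 829 * u ^ 4 - 1821 * u ^ 2 + 576"
proof -
  have "P\<^sup>2 / Q\<^sup>2 + 2 + Q\<^sup>2 / P\<^sup>2 = u\<^sup>2"
    unfolding u using assms(1,2) by (simp add: field_simps power2_eq_square)
  moreover have "P\<^sup>2 + Q\<^sup>2 + 169 / P\<^sup>2 + 169 / Q\<^sup>2 = B * u"
    unfolding u B using assms(1,2) by (simp add: field_simps power2_eq_square)
  moreover have "P\<^sup>2 * Q\<^sup>2 + 338 + 28561 / (P\<^sup>2 * Q\<^sup>2) = B\<^sup>2"
    unfolding B using assms(1,2) by (simp add: field_simps power2_eq_square)
  ultimately have "B\<^sup>2 - B * u * ((u\<^sup>2) ^ 4 - (u\<^sup>2) ^ 3 - 21 * (u\<^sup>2) ^ 2 + 35 * u\<^sup>2 + 30)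
      + (u\<^sup>2) ^ 6 + 4 * (u\<^sup>2) ^ 5 - 26 * (u\<^sup>2) ^ 4 + 89 * (u\<^sup>2) ^ 3 - 829 * (u\<^sup>2) ^ 2 + 1821 * u\<^sup>2 - 576 = 0"
    using rel unfolding modular_relation_def Let_def by simp
  thus ?thesis
    by algebra
qed

theorem theorem3p2:
  fixes \<tau> q P Q u B :: complex
  assumes "Im \<tau> > 0"
    and "q = qpow \<tau> 1"
    and "P = ramanujan_f (- q) * ramanujan_f (- (q ^ 4)) /
             (qpow \<tau> (5 / 2) * ramanujan_f (- (q ^ 13)) * ramanujan_f (- (q ^ 52)))"
    and "Q = ramanujan_f (- (q ^ 2)) ^ 2 / (q ^ 2 * ramanujan_f (- (q ^ 26)) ^ 2)"
    and "u = P / Q + Q / P"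
    and "B = P * Q + 169 / (P * Q)"
  shows "B ^ 2 = B * (u ^ 9 - u ^ 7 - 21 * u ^ 5 + 35 * u ^ 3 + 30 * u)
           - u ^ 12 - 4 * u ^ 10 + 26 * u ^ 8 - 89 * u ^ 6 + 829 * u ^ 4 - 1821 * u ^ 2 + 576"
proof -
  \<comment> \<open>The half shift replaces \<open>q\<close> by \<open>-q\<close>, which trades the
    products at 1, 4, 13, 52 for those at 1, 2, 13, 26.\<close>
  define \<sigma> where "\<sigma> = \<tau> + 1/2"
  have sigma: "Im \<sigma> > 0"
    using assms(1) by (simp add: \<sigma>_def)
  have q: "norm q < 1" and q0: "q \<noteq> 0"
    using norm_qpow_less_1[OF assms(1), of 1] by (simp_all add: assms(2))
  have qm: "qpow \<sigma> 1 = - q"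
  proof -
    have "2 * of_real pi * \<i> * of_real 1 * \<sigma> = 2 * of_real pi * \<i> * of_real 1 * \<tau> + of_real pi * \<i>"
      by (simp add: \<sigma>_def algebra_simps)
    thus ?thesis
      unfolding assms(2) qpow_def by (simp only: exp_add exp_pi_i mult_minus1_right)
  qed
  have nz: "qp (x ^ k) (x ^ k) \<noteq> 0" if "k > 0" "norm x < 1" for x k
    using that by (intro qp_same_nonzero) (simp add: norm_power power_less_one_iff)
  have f: "ramanujan_f (- x) = qp x x" for x
    by (simp add: ramanujan_f_def)
  have qp52: "qpow \<tau> (5 / 2) ^ 2 = q ^ 5"
    by (simp add: assms(2) qpow_power)
  have P0: "P \<noteq> 0" and Q0: "Q \<noteq> 0"
    using nz[of 1 q] nz[of 2 q] nz[of 4 q] nz[of 13 q] nz[of 26 q] nz[of 52 q] q q0 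
    by (simp_all add: assms(3,4) f)
  have e1: "qp q q * qp (q ^ 4) (q ^ 4) = qp (q\<^sup>2) (q\<^sup>2) ^ 3 / qp (-q) (-q)"
    using euler_minus[OF q] nz[of 1 "-q"] q by (simp add: field_simps)
  have q13: "norm (q ^ 13) < 1"
    using q by (simp add: norm_power power_less_one_iff)
  \<comment> \<open>Since 13 is odd, \<open>- (q ^ 13) = (-q) ^ 13\<close>, so the product on the
    right is the Euler product at 13 evaluated at \<open>-q\<close>.\<close>
  have e13: "qp (q ^ 13) (q ^ 13) * qp (q ^ 52) (q ^ 52) = qp (q ^ 26) (q ^ 26) ^ 3 / qp (-(q ^ 13)) (-(q ^ 13))"
    using euler_minus[OF q13] nz[of 13 "-q"] q by (simp add: field_simps flip: power_mult)
  have C: "etaC \<sigma> = Q"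
    using etaA_etaC_q_expansion(2)[OF sigma] by (simp add: qm assms(4) f)
  have "P\<^sup>2 = ((qp q q * qp (q ^ 4) (q ^ 4)) / (qp (q ^ 13) (q ^ 13) * qp (q ^ 52) (q ^ 52)))\<^sup>2 / q ^ 5"
    by (simp add: assms(3) f power_mult_distrib power_divide qp52 mult_ac)
  \<comment> \<open>The sign comes from \<open>(-q) ^ 5\<close> in the expansion of
    \<open>etaA\<close>; the products at 2 and 26 involve only even powers of
    \<open>q\<close>.\<close>
  also have "\<dots> = - etaA \<sigma>"
    unfolding etaA_etaC_q_expansion(1)[OF sigma] qm e1 e13
    by (simp add: power_mult_distrib power_divide mult_ac flip: power_mult)
  finally have "modular_relation (P\<^sup>2) Q = 0"
    using relation_fun_eq_0[OF sigma] by (simp add: relation_fun_def C)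
  from modular_relation_eq_0D[OF P0 Q0 this assms(5,6)] show ?thesis .
qed

end
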